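(* Let $\epsilon>0$ be fixed, let $\delta_n>0$ be a vanishing sequence and let $q_n\in L^\alpha(\Omega_\epsilon;\mathbb R^d)$ be corresponding solutions of the doubly regularized problem, i.e. minimizers of $\int_{\Omega_\epsilon}\mathcal G^*_{\epsilon,\delta_n}(x,q(x))\,dx$ over all $q\in L^\alpha(\Omega_\epsilon;\mathbb R^d)$ with $\operatorname{div}q=\tilde\mu$ in $W^{-1,\alpha}_\perp(\Omega_\epsilon)$. Then $(q_n)$ admits a subsequence that converges, with respect to weak-$*$ convergence in $\mathcal M(\Omega_\epsilon;\mathbb R^d)$, to a solution of the regularized Beckmann problem on $\Omega_\epsilon$, i.e. to a minimizer of $$\int_{\Omega_\epsilon}\hat w\,|q|\,dx+\frac\epsilon\alpha\|q\|^\alpha_{L^\alpha(\Omega_\epsilon)}\quad\text{over } q\in L^\alpha(\Omega_\epsilon;\mathbb R^d)\text{ with }\operatorname{div}q=\tilde\mu\text{ in }W^{-1,\alpha}_\perp(\Omega_\epsilon).$$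
   Context: Setting: $d\in\mathbb N$; $\Omega\subset\mathbb R^d$ is compact and its interior $\Omega^\circ$ is a bounded Lipschitz domain; $\Omega$ is strictly star shaped with respect to $0$: $\lambda x\in\Omega^\circ$ for all $x\in\Omega$, $0\le\lambda<1$; $w:\Omega\to[0,\infty)$ is continuous; $1<\alpha<\frac{d}{d-1}$, $\alpha'=\frac{\alpha}{\alpha-1}$; $\mu^+,\mu^-$ are Borel probability measures on $\Omega$, $\mu:=\mu^+-\mu^-$. $|\cdot|$ is the Euclidean norm, $dx$ Lebesgue measure, $\mathcal M(K;\mathbb R^d)$ the $\mathbb R^d$-valued Radon measures on a compact set $K$ (weak-$*$ topology as dual of $C(K;\mathbb R^d)$); integrable functions are identified with measures via their densities. Spaces, for a compact set $K$ (here $K=\Omega$ or $K=\Omega_\epsilon$ below; Sobolev spaces on the interior): $W^{1,p}_\emptyset(K)=\{v\in W^{1,p}(K):\int_K v\,dx=0\}$; $W^{-1,p}_\perp(K)=\{v\in(W^{1,p'}(K))^*:\langle v,1\rangle=0\}$ with $p'$ conjugate to $p$; $\operatorname{div}:L^p(K;\mathbb R^d)\to W^{-1,p}_\perp(K)$, $\langle\operatorname{div}q,\phi\rangle=-\int_K q\cdot\nabla\phi\,dx$ for $\phi\in W^{1,p'}_\emptyset(K)$. Measures with total mass zero are regarded as elements of $W^{-1,\alpha}_\perp(K)$ (since $W^{1,\alpha'}(K)\hookrightarrow C(K)$). Assumption on $\Omega$: for every $\nu\in W^{-1,\alpha'}_\perp(\Omega)$ there is a unique $y\in W^{1,\alpha'}_\emptyset(\Omega)$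 with $-\int_\Omega\nabla y\cdot\nabla\phi\,dx=\langle\nu,\phi\rangle$ for all $\phi\in W^{1,\alpha}_\emptyset(\Omega)$. Enlarged domains: fix a sequence of parameters $\tau>0$, $\tau\to0$, and nonnegative mollifiers $\phi_\tau\in C_c^\infty(\mathbb R^d)$ ($\int\phi_\tau=1$, supports shrinking to $\{0\}$). For each $\tau$ choose $s_\tau>0$, $s_\tau\to0$, such that $\Omega_\tau:=(1+s_\tau)\Omega\supset\Omega+\operatorname{supp}\phi_\tau$ and $\Omega_\tau\supset\Omega_\vartheta$ for $\tau>\vartheta$. Put $\tilde\Omega=\bigcup_\tau\Omega_\tau$. $\tilde\mu$ denotes the extension of $\mu$ by zero; $\hat w$ is a continuous extension of $w$ to $\tilde\Omega$ with $\min_{\tilde\Omega}\hat w=\min_\Omega w$. $\epsilon$ is one of these parameters and $\Omega_\epsilon$ the corresponding domain. Integrand: for $\delta>0$, $\mathcal G^*_{\epsilon,\delta}(x,q)=|q|^2\frac{\hat w(x)}{2\delta}-\delta\hat w(x)$ if $|q|\le\delta$, and $\mathcal G^*_{\epsilon,\delta}(x,q)=\frac\epsilon\alpha(|q|-\delta)^\alpha-\frac32\delta\hat w(x)+|q|\hat w(x)$ otherwise. *)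

theory Defs
  imports "HOL-Probability.Probability"
begin

section \<open>Domains and test functions\<close>

text \<open>
  Near each boundary point, in suitable orthonormal coordinates, the set is the strict epigraph
  of a Lipschitz function. The coordinate system is encoded by its last axis \<open>e\<close>; the Lipschitz
  function is only evaluated on the hyperplane orthogonal to \<open>e\<close>.
\<close>
definition lipschitz_boundary :: "(real^'d) set \<Rightarrow> bool" where
  "lipschitz_boundary U \<longleftrightarrow>
     (\<forall>x\<in>frontier U. \<exists>r>0. \<exists>e g L. norm e = 1 \<and> L-lipschitz_on UNIV g \<and>
        U \<inter> ball x r = {y \<in> ball x r. g (y - (y \<bullet> e) *\<^sub>R e) < y \<bullet> e})"

definition bounded_lipschitz_domain :: "(real^'d) set \<Rightarrow> bool" where
  "bounded_lipschitz_domain U \<longleftrightarrow>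
     open U \<and> connected U \<and> U \<noteq> {} \<and> bounded U \<and> lipschitz_boundary U"

definition partial :: "'d \<Rightarrow> (real^'d \<Rightarrow> real) \<Rightarrow> real^'d \<Rightarrow> real" where
  "partial i f x = frechet_derivative f (at x) (axis i 1)"

primrec C_k :: "nat \<Rightarrow> (real^'d \<Rightarrow> real) \<Rightarrow> bool" where
  "C_k 0 f \<longleftrightarrow> continuous_on UNIV f"
| "C_k (Suc k) f \<longleftrightarrow> (\<forall>x. f differentiable (at x)) \<and> (\<forall>i. C_k k (partial i f))"

definition supp :: "(real^'d \<Rightarrow> real) \<Rightarrow> (real^'d) set" where
  "supp f = closure {x. f x \<noteq> 0}"

definition Cc_infinity :: "(real^'d) set \<Rightarrow> (real^'d \<Rightarrow> real) set" where
  "Cc_infinity U = {f. (\<forall>k. C_k k f) \<and> compact (supp f) \<and> supp f \<subseteq> U}"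


section \<open>Lebesgue and Sobolev spaces\<close>

text \<open>
  All spaces consist of functions rather than of classes modulo null sets. A compact set \<open>K\<close>
  stands for its interior in the Sobolev spaces; whenever the interior is a bounded Lipschitz
  domain with closure \<open>K\<close>, the set \<open>K\<close> differs from its interior only by a null set.
\<close>

definition conj_exp :: "real \<Rightarrow> real" where
  "conj_exp p = p / (p - 1)"

definition Lp :: "real \<Rightarrow> (real^'d) set \<Rightarrow> (real^'d \<Rightarrow> 'b::euclidean_space) set" where
  "Lp p K = {f \<in> borel_measurable (lebesgue_on K).
               integrable (lebesgue_on K) (\<lambda>x. norm (f x) powr p)}"

definition Lp_norm :: "real \<Rightarrow> (real^'d) set \<Rightarrow> (real^'d \<Rightarrow> 'b::euclidean_space) \<Rightarrow> real" where
  "Lp_norm p K f = (\<integral>x. norm (f x) powr p \<partial>lebesgue_on K) powr (1 / p)"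

definition weak_gradient ::
  "(real^'d) set \<Rightarrow> (real^'d \<Rightarrow> real) \<Rightarrow> (real^'d \<Rightarrow> real^'d) \<Rightarrow> bool" where
  "weak_gradient U v g \<longleftrightarrow>
     (\<forall>\<psi>\<in>Cc_infinity U. \<forall>i.
        (\<integral>x. v x * partial i \<psi> x \<partial>lebesgue_on U) = - (\<integral>x. g x $ i * \<psi> x \<partial>lebesgue_on U))"

definition W1 :: "real \<Rightarrow> (real^'d) set \<Rightarrow> (real^'d \<Rightarrow> real) set" where
  "W1 p K = {v \<in> Lp p K. \<exists>g\<in>Lp p K. weak_gradient (interior K) v g}"

text \<open>The choice of a representative is immaterial: weak gradients are unique almost everywhere.\<close>
definition grad :: "real \<Rightarrow> (real^'d) set \<Rightarrow> (real^'d \<Rightarrow> real) \<Rightarrow> real^'d \<Rightarrow> real^'d" where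
  "grad p K v = (SOME g. g \<in> Lp p K \<and> weak_gradient (interior K) v g)"

definition W1_norm :: "real \<Rightarrow> (real^'d) set \<Rightarrow> (real^'d \<Rightarrow> real) \<Rightarrow> real" where
  "W1_norm p K v = (Lp_norm p K v powr p + Lp_norm p K (grad p K v) powr p) powr (1 / p)"

definition W1_mean0 :: "real \<Rightarrow> (real^'d) set \<Rightarrow> (real^'d \<Rightarrow> real) set" where
  "W1_mean0 p K = {v \<in> W1 p K. (\<integral>x. v x \<partial>lebesgue_on K) = 0}"

text \<open>
  Functionals are total on functions, but only their values on \<open>W1\<close> matter. Boundedness in the
  Sobolev norm forces them to respect equality almost everywhere.
\<close>
definition W_neg1_perp :: "real \<Rightarrow> (real^'d) set \<Rightarrow> ((real^'d \<Rightarrow> real) \<Rightarrow> real) set" where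
  "W_neg1_perp p K = {\<nu>.
     (\<forall>u\<in>W1 (conj_exp p) K. \<forall>v\<in>W1 (conj_exp p) K. \<nu> (\<lambda>x. u x + v x) = \<nu> u + \<nu> v) \<and>
     (\<forall>c. \<forall>u\<in>W1 (conj_exp p) K. \<nu> (\<lambda>x. c * u x) = c * \<nu> u) \<and>
     (\<exists>C. \<forall>u\<in>W1 (conj_exp p) K. \<bar>\<nu> u\<bar> \<le> C * W1_norm (conj_exp p) K u) \<and>
     \<nu> (\<lambda>x. 1) = 0}"

definition neumann_solution ::
  "real \<Rightarrow> (real^'d) set \<Rightarrow> ((real^'d \<Rightarrow> real) \<Rightarrow> real) \<Rightarrow> (real^'d \<Rightarrow> real) \<Rightarrow> bool" where
  "neumann_solution p K \<nu> y \<longleftrightarrow> y \<in> W1_mean0 p K \<and>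
     (\<forall>\<phi>\<in>W1_mean0 (conj_exp p) K.
        - (\<integral>x. grad p K y x \<bullet> grad (conj_exp p) K \<phi> x \<partial>lebesgue_on K) = \<nu> \<phi>)"

definition neumann_uniquely_solvable :: "real \<Rightarrow> (real^'d) set \<Rightarrow> bool" where
  "neumann_uniquely_solvable p K \<longleftrightarrow>
     (\<forall>\<nu>\<in>W_neg1_perp p K. \<exists>y. neumann_solution p K \<nu> y \<and>
        (\<forall>z. neumann_solution p K \<nu> z \<longrightarrow> (AE x in lebesgue_on K. z x = y x)))"


section \<open>Measures and the divergence constraint\<close>

definition borel_prob_on :: "(real^'d) set \<Rightarrow> (real^'d) measure \<Rightarrow> bool" where
  "borel_prob_on K M \<longleftrightarrow> prob_space M \<and> sets M = sets (restrict_space borel K)"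

definition extension_by_zero :: "(real^'d) set \<Rightarrow> (real^'d) measure \<Rightarrow> (real^'d) measure" where
  "extension_by_zero K M = distr M (restrict_space borel K) (\<lambda>x. x)"

text \<open>The embedding of \<open>W1 p K\<close> into \<open>C(K)\<close> for \<open>p > d\<close>.\<close>
definition continuous_rep :: "(real^'d) set \<Rightarrow> (real^'d \<Rightarrow> real) \<Rightarrow> real^'d \<Rightarrow> real" where
  "continuous_rep K \<phi> = (SOME u. continuous_on K u \<and> (AE x in lebesgue_on K. u x = \<phi> x))"

text \<open>The signed measure \<open>P - N\<close> on \<open>K\<close> as a functional on \<open>W1\<close>.\<close>
definition measure_functional ::
  "(real^'d) set \<Rightarrow> (real^'d) measure \<Rightarrow> (real^'d) measure \<Rightarrow> (real^'d \<Rightarrow> real) \<Rightarrow> real" where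
  "measure_functional K P N \<phi> =
     (\<integral>x. continuous_rep K \<phi> x \<partial>P) - (\<integral>x. continuous_rep K \<phi> x \<partial>N)"

definition divergence ::
  "real \<Rightarrow> (real^'d) set \<Rightarrow> (real^'d \<Rightarrow> real^'d) \<Rightarrow> (real^'d \<Rightarrow> real) \<Rightarrow> real" where
  "divergence p K q \<phi> = - (\<integral>x. q x \<bullet> grad (conj_exp p) K \<phi> x \<partial>lebesgue_on K)"

text \<open>
  Elements of \<open>W_neg1_perp\<close> vanish on constants, so that their equality is equality on the
  functions of mean zero.
\<close>
definition admissible ::
  "real \<Rightarrow> (real^'d) set \<Rightarrow> (real^'d) measure \<Rightarrow> (real^'d) measure \<Rightarrow> (real^'d \<Rightarrow> real^'d) set" where
  "admissible p K P N = {q \<in> Lp p K.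
     \<forall>\<phi>\<in>W1_mean0 (conj_exp p) K. divergence p K q \<phi> = measure_functional K P N \<phi>}"


section \<open>Weak-* convergence of vector measures\<close>

text \<open>
  Vector-valued Radon measures on a compact set, as the dual of the continuous vector fields with
  the supremum norm; as above, only the values on continuous vector fields matter.
\<close>
definition vector_radon_measures :: "(real^'d) set \<Rightarrow> ((real^'d \<Rightarrow> real^'d) \<Rightarrow> real) set" where
  "vector_radon_measures K = {\<Lambda>.
     (\<forall>\<psi> \<eta>. continuous_on K \<psi> \<longrightarrow> continuous_on K \<eta> \<longrightarrow>
        \<Lambda> (\<lambda>x. \<psi> x + \<eta> x) = \<Lambda> \<psi> + \<Lambda> \<eta>) \<and>
     (\<forall>c \<psi>. continuous_on K \<psi> \<longrightarrow> \<Lambda> (\<lambda>x. c *\<^sub>R \<psi> x) = c * \<Lambda> \<psi>) \<and>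
     (\<exists>C. \<forall>\<psi>. continuous_on K \<psi> \<longrightarrow> \<bar>\<Lambda> \<psi>\<bar> \<le> C * (SUP x\<in>K. norm (\<psi> x)))}"

definition density_measure ::
  "(real^'d) set \<Rightarrow> (real^'d \<Rightarrow> real^'d) \<Rightarrow> (real^'d \<Rightarrow> real^'d) \<Rightarrow> real" where
  "density_measure K q \<psi> = (\<integral>x. \<psi> x \<bullet> q x \<partial>lebesgue_on K)"

definition weak_star_converges ::
  "(real^'d) set \<Rightarrow> (nat \<Rightarrow> (real^'d \<Rightarrow> real^'d) \<Rightarrow> real) \<Rightarrow> ((real^'d \<Rightarrow> real^'d) \<Rightarrow> real) \<Rightarrow> bool"
  where
  "weak_star_converges K \<Lambda> \<Lambda>\<^sub>0 \<longleftrightarrow>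
     (\<forall>n. \<Lambda> n \<in> vector_radon_measures K) \<and> \<Lambda>\<^sub>0 \<in> vector_radon_measures K \<and>
     (\<forall>\<psi>. continuous_on K \<psi> \<longrightarrow> (\<lambda>n. \<Lambda> n \<psi>) \<longlonglongrightarrow> \<Lambda>\<^sub>0 \<psi>)"


section \<open>Enlarged domains and the regularized problems\<close>

definition enlarge :: "(real^'d) set \<Rightarrow> real \<Rightarrow> (real^'d) set" where
  "enlarge \<Omega> s = (\<lambda>x. (1 + s) *\<^sub>R x) ` \<Omega>"

definition is_minimum_value :: "('a \<Rightarrow> real) \<Rightarrow> 'a set \<Rightarrow> real \<Rightarrow> bool" where
  "is_minimum_value f A m \<longleftrightarrow> m \<in> f ` A \<and> (\<forall>x\<in>A. m \<le> f x)"

definition G_star ::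
  "real \<Rightarrow> real \<Rightarrow> real \<Rightarrow> (real^'d \<Rightarrow> real) \<Rightarrow> real^'d \<Rightarrow> real^'d \<Rightarrow> real" where
  "G_star \<alpha> \<epsilon> \<delta> w x q =
     (if norm q \<le> \<delta> then (norm q)\<^sup>2 * (w x / (2 * \<delta>)) - \<delta> * w x
      else \<epsilon> / \<alpha> * (norm q - \<delta>) powr \<alpha> - 3 / 2 * \<delta> * w x + norm q * w x)"

definition doubly_regularized_energy ::
  "real \<Rightarrow> real \<Rightarrow> real \<Rightarrow> (real^'d \<Rightarrow> real) \<Rightarrow> (real^'d) set \<Rightarrow> (real^'d \<Rightarrow> real^'d) \<Rightarrow> real" where
  "doubly_regularized_energy \<alpha> \<epsilon> \<delta> w K q = (\<integral>x. G_star \<alpha> \<epsilon> \<delta> w x (q x) \<partial>lebesgue_on K)"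

definition regularized_beckmann_energy ::
  "real \<Rightarrow> real \<Rightarrow> (real^'d \<Rightarrow> real) \<Rightarrow> (real^'d) set \<Rightarrow> (real^'d \<Rightarrow> real^'d) \<Rightarrow> real" where
  "regularized_beckmann_energy \<alpha> \<epsilon> w K q =
     (\<integral>x. w x * norm (q x) \<partial>lebesgue_on K) + \<epsilon> / \<alpha> * Lp_norm \<alpha> K q powr \<alpha>"

end

theory Submission
  imports Defs
begin

text \<open>
  The convergence is even strong in \<open>L\<^sup>\<alpha>\<close>. The doubly regularized integrand differs from that of the
  regularized Beckmann problem by at most \<open>\<kappa>\<^sub>n (1 + |q|\<^sup>\<alpha>)\<close> with \<open>\<kappa>\<^sub>n\<close> tending to \<open>0\<close>, so the minimizers \<open>q\<^sub>n\<close> form a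
  minimizing sequence of the limit energy. Strict convexity of \<open>|\<cdot>|\<^sup>\<alpha>\<close>, made uniform by homogeneity
  and compactness of the unit sphere, makes every minimizing sequence in the midpoint-convex
  admissible set Cauchy in \<open>L\<^sup>\<alpha>\<close>. The divergence constraint tests against fixed functions in the
  dual Lebesgue space and hence passes to the limit, and Fatou's lemma gives minimality.
\<close>

section \<open>Uniform convexity of powers of the norm\<close>

text \<open>The exponent may lie below 2, and then \<open>norm (a - b) powr p\<close> is not bounded
  by a multiple of the midpoint defect of \<open>|.|^p\<close>: near a nonzero point of the diagonal
  the defect is quadratic in \<open>a - b\<close>, whereas the left side is of the lower order p.
  Hence the small extra term \<open>\<eta> * (norm a powr p + norm b powr p)\<close>, which is
  harmless because the p-th powers along a minimizing sequence have bounded integrals. The weighted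
  norm is convex but not strictly convex, and it is not coercive where the weight vanishes. Both the
  Cauchy estimate and the bound in the Lebesgue norm therefore come from the power term, whose
  coefficient stays fixed while \<delta> tends to 0. No minimizer of the limit problem is
  presupposed: energies are compared with the infimum, and the limit of the sequence supplies the
  minimizer. As the error is controlled by the same power that gives coercivity, a competitor can be
  inserted unchanged into both problems.\<close>

lemma powr_gt_tangent:
  fixes m x p :: real
  assumes p: "1 < p" and m: "0 < m" and x: "0 \<le> x" "x \<noteq> m"
  shows "m powr p + p * m powr (p - 1) * (x - m) < x powr p"
proof -
  have der: "((\<lambda>u. u powr p) has_real_derivative p * u powr (p - 1)) (at u)" if "0 < u" for u
    using that by (auto intro!: derivative_eq_intros)
  consider "x = 0" | "0 < x" "x < m" | "m < x"
    using x by linarith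
  then show ?thesis
  proof cases
    case 1
    have "m powr (p - 1) * m = m powr p"
      using m powr_mult_base[of m "p - 1"] by (simp add: mult.commute)
    then have "p * m powr (p - 1) * (x - m) = - (p * m powr p)"
      using 1 by (simp add: mult.assoc)
    moreover have "1 * m powr p < p * m powr p"
      using p m by (intro mult_strict_right_mono) auto
    moreover have "x powr p = 0"
      using 1 by simp
    ultimately show ?thesis by linarith
  next
    case 2
    then obtain z where z: "x < z" "z < m"
        "m powr p - x powr p = (m - x) * (p * z powr (p - 1))"
      using MVT2[of x m "\<lambda>u. u powr p" "\<lambda>u. p * u powr (p - 1)"] der by force
    have "z powr (p - 1) < m powr (p - 1)"
      using z 2 p by (intro powr_less_mono2) auto
    then have "(m - x) * (p * z powr (p - 1)) < (m - x) * (p * m powr (p - 1))"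
      using 2 p by simp
    then show ?thesis using z(3) by (simp add: algebra_simps)
  next
    case 3
    then obtain z where z: "m < z" "z < x"
        "x powr p - m powr p = (x - m) * (p * z powr (p - 1))"
      using MVT2[of m x "\<lambda>u. u powr p" "\<lambda>u. p * u powr (p - 1)"] der m by force
    have "m powr (p - 1) < z powr (p - 1)"
      using z m p by (intro powr_less_mono2) auto
    then have "(x - m) * (p * m powr (p - 1)) < (x - m) * (p * z powr (p - 1))"
      using 3 p by simp
    then show ?thesis using z(3) by (simp add: algebra_simps)
  qed
qed

lemma powr_ge_tangent:
  fixes m x p :: real
  assumes "1 < p" "0 < m" "0 \<le> x"
  shows "m powr p + p * m powr (p - 1) * (x - m) \<le> x powr p"
  using powr_gt_tangent[of p m x] assms by (cases "x = m") auto

text \<open>The strict tangent inequalities at the midpoint are added; their linear terms cancel.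
  The midpoint is positive because two distinct nonnegative numbers cannot both vanish.\<close>

lemma powr_midpoint_less:
  fixes x y p :: real
  assumes "1 < p" "0 \<le> x" "0 \<le> y" "x \<noteq> y"
  shows "((x + y) / 2) powr p < (x powr p + y powr p) / 2"
proof -
  define m where "m = (x + y) / 2"
  have m: "0 < m" "x \<noteq> m" "y \<noteq> m"
    using assms by (auto simp: m_def)
  have "m powr p + p * m powr (p - 1) * (x - m) < x powr p"
       "m powr p + p * m powr (p - 1) * (y - m) < y powr p"
    using powr_gt_tangent assms m by blast+
  moreover have "p * m powr (p - 1) * (y - m) = - (p * m powr (p - 1) * (x - m))"
    by (simp add: m_def field_simps)
  ultimately have "2 * m powr p < x powr p + y powr p"
    by simp
  then show ?thesis unfolding m_def by simp
qed

lemma powr_midpoint_le: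
  fixes x y p :: real
  assumes "1 < p" "0 \<le> x" "0 \<le> y"
  shows "((x + y) / 2) powr p \<le> (x powr p + y powr p) / 2"
  using powr_midpoint_less[of p x y] assms by (cases "x = y") auto

text \<open>The defect in the midpoint convexity of \<open>|.|^p\<close>. It is homogeneous of
  degree p and vanishes on the diagonal, and its integral is what nearly minimal energies
  control.\<close>

definition midpoint_gap :: "real \<Rightarrow> 'a::euclidean_space \<Rightarrow> 'a \<Rightarrow> real" where
  "midpoint_gap p a b = (norm a powr p + norm b powr p) / 2 - norm ((1 / 2) *\<^sub>R (a + b)) powr p"

lemma norm_midpoint_le: "norm ((1 / 2) *\<^sub>R (a + b)) \<le> (norm a + norm b) / 2"
  for a b :: "'a::real_normed_vector"
  using norm_triangle_ineq[of a b] by simp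

lemma midpoint_gap_nonneg: "1 < p \<Longrightarrow> 0 \<le> midpoint_gap p a b"
  using powr_midpoint_le[of p "norm a" "norm b"]
    powr_mono2[OF _ _ norm_midpoint_le[of a b], of p]
  by (auto simp: midpoint_gap_def)

text \<open>Strictness has two sources. If the norms differ, it is the strict convexity of the
  scalar power. If they agree, the parallelogram identity makes the midpoint strictly shorter than
  both vectors.\<close>

lemma midpoint_gap_pos:
  assumes p: "1 < p" and ab: "a \<noteq> b"
  shows "0 < midpoint_gap p a b"
proof (cases "norm a = norm b")
  case False
  then have "((norm a + norm b) / 2) powr p < (norm a powr p + norm b powr p) / 2"
    using p by (intro powr_midpoint_less) auto
  then show ?thesis
    using powr_mono2[OF _ _ norm_midpoint_le[of a b], of p] p by (auto simp: midpoint_gap_def)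
next
  case True
  have "(norm (a + b))\<^sup>2 + (norm (a - b))\<^sup>2 = 2 * (norm a)\<^sup>2 + 2 * (norm b)\<^sup>2"
    by (simp add: power2_norm_eq_inner inner_add inner_diff inner_commute)
  moreover have "0 < (norm (a - b))\<^sup>2"
    using ab by simp
  moreover have "(2 * norm a)\<^sup>2 = 2 * (norm a)\<^sup>2 + 2 * (norm b)\<^sup>2"
    using True by (simp add: power_mult_distrib)
  ultimately have "(norm (a + b))\<^sup>2 < (2 * norm a)\<^sup>2"
    by linarith
  then have "norm (a + b) < 2 * norm a"
    by (rule power2_less_imp_less) auto
  then have "norm ((1 / 2) *\<^sub>R (a + b)) powr p < norm a powr p"
    using p by (intro powr_less_mono2) auto
  then show ?thesis using True by (simp add: midpoint_gap_def)
qed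

lemma midpoint_gap_scale:
  assumes "0 \<le> t"
  shows "midpoint_gap p (t *\<^sub>R a) (t *\<^sub>R b) = t powr p * midpoint_gap p a b"
proof -
  have "norm (t *\<^sub>R v) powr p = t powr p * norm v powr p" for v :: 'a
    using assms by (simp add: powr_mult)
  moreover have "(1 / 2) *\<^sub>R (t *\<^sub>R a + t *\<^sub>R b) = t *\<^sub>R ((1 / 2) *\<^sub>R (a + b))"
    by (simp add: scaleR_add_right)
  ultimately show ?thesis
    unfolding midpoint_gap_def by (simp only: ring_distribs times_divide_eq_right)
qed

text \<open>By homogeneity it suffices to compare both sides on the unit sphere, where the gap has
  a positive minimum on the compact part on which \<open>\<eta> (|a|^p + |b|^p)\<close> is too small.\<close>
lemma norm_diff_powr_le_midpoint_gap:
  assumes p: "1 < p" and eta: "0 < \<eta>"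
  shows "\<exists>C\<ge>0. \<forall>a b :: 'a::euclidean_space.
    norm (a - b) powr p \<le> \<eta> * (norm a powr p + norm b powr p) + C * midpoint_gap p a b"
proof -
  define D where "D z = norm (fst z - snd z) powr p" for z :: "'a \<times> 'a"
  define N where "N z = norm (fst z) powr p + norm (snd z) powr p" for z :: "'a \<times> 'a"
  define H where "H z = midpoint_gap p (fst z) (snd z)" for z :: "'a \<times> 'a"
  have cD: "continuous_on UNIV D" and cN: "continuous_on UNIV N" and cH: "continuous_on UNIV H"
    unfolding D_def N_def H_def midpoint_gap_def using p
    by (auto intro!: continuous_intros continuous_on_powr')
  define S where "S = sphere 0 1 \<inter> {z. \<eta> * N z \<le> D z}"
  have "closed {z. \<eta> * N z \<le> D z}"
    using cD cN by (intro closed_Collect_le continuous_intros)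
  then have S: "compact S"
    unfolding S_def by (intro compact_Int_closed) auto
  \<comment> \<open>\<open>S\<close> avoids the diagonal: on the sphere \<open>N\<close> is
    positive, so membership in \<open>S\<close> forces \<open>D\<close> to be positive, and off the
    diagonal the gap is positive.\<close>
  have Hpos: "0 < H z" if "z \<in> S" for z
  proof -
    have "z \<noteq> 0" using that by (auto simp: S_def)
    then have "0 < N z"
      unfolding N_def by (cases z) (auto simp: add_pos_nonneg add_nonneg_pos zero_prod_def)
    with eta that have "0 < D z"
      unfolding S_def using less_le_trans[OF mult_pos_pos[of \<eta> "N z"], of "D z"] by blast
    then have "fst z \<noteq> snd z"
      by (auto simp: D_def)
    then show ?thesis unfolding H_def by (rule midpoint_gap_pos[OF p])
  qed
  \<comment> \<open>The constant is the maximum of \<open>D / H\<close> over \<open>S\<close>. For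
    large \<eta> the set \<open>S\<close> is empty and every nonnegative constant works.\<close>
  have "\<exists>C\<ge>0. \<forall>z\<in>S. D z \<le> C * H z"
  proof (cases "S = {}")
    case False
    obtain x where x: "x \<in> S" "\<And>z. z \<in> S \<Longrightarrow> D z / H z \<le> D x / H x"
    proof -
      have "continuous_on S (\<lambda>z. D z / H z)"
        using cD cH Hpos by (auto intro!: continuous_intros intro: continuous_on_subset simp: less_imp_neq[symmetric])
      then show ?thesis
        using continuous_attains_sup[OF S False] that by blast
    qed
    have "D z \<le> (D x / H x) * H z" if "z \<in> S" for z
      using x(2)[OF that] Hpos[OF that] by (simp add: pos_divide_le_eq)
    moreover have "0 \<le> D x / H x"
      using Hpos[OF x(1)] by (simp add: D_def)
    ultimately show ?thesis by blast
  qed auto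
  then obtain C where C: "0 \<le> C" "\<And>z. z \<in> S \<Longrightarrow> D z \<le> C * H z" by blast
  have unit: "D z \<le> \<eta> * N z + C * H z" if "norm z = 1" for z
  proof (cases "z \<in> S")
    case True
    moreover have "0 \<le> \<eta> * N z" using eta by (simp add: N_def)
    ultimately show ?thesis using C(2)[of z] by linarith
  next
    case False
    then have "D z < \<eta> * N z" using that by (auto simp: S_def)
    moreover have "0 \<le> C * H z" using C(1) midpoint_gap_nonneg[OF p] unfolding H_def by (rule mult_nonneg_nonneg)
    ultimately show ?thesis by linarith
  qed
  have all: "D z \<le> \<eta> * N z + C * H z" for z
  proof (cases "z = 0")
    case True
    then show ?thesis by (simp add: D_def N_def H_def midpoint_gap_def)
  next
    case False
    define t where "t = norm z"
    define u where "u = (1 / t) *\<^sub>R z"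
    have t: "0 < t" and z: "z = t *\<^sub>R u" and u: "norm u = 1"
      using False by (auto simp: t_def u_def)
    have "D z = t powr p * D u"
    proof -
      have "fst z - snd z = t *\<^sub>R (fst u - snd u)"
        by (simp add: z scaleR_diff_right)
      then show ?thesis using t by (simp add: D_def powr_mult)
    qed
    moreover have "N z = t powr p * N u"
      using t by (simp add: N_def z powr_mult ring_distribs)
    moreover have "H z = t powr p * H u"
      using midpoint_gap_scale[of t p "fst u" "snd u"] t by (simp add: H_def z)
    moreover have "t powr p * D u \<le> t powr p * (\<eta> * N u + C * H u)"
      using unit[OF u] by (intro mult_left_mono) auto
    ultimately show ?thesis by (simp add: algebra_simps)
  qed
  show ?thesis
    using C(1) all[of "(a, b)" for a b] by (auto simp: D_def N_def H_def)
qed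

text \<open>Midpoint convexity after doubling. The constant is not optimal, since the bound only
  serves integrability of sums.\<close>

lemma norm_add_powr_le:
  fixes a b :: "'a::real_normed_vector"
  assumes p: "1 < p"
  shows "norm (a + b) powr p \<le> 2 powr p * (norm a powr p + norm b powr p)"
proof -
  have "norm (a + b) \<le> 2 * ((norm a + norm b) / 2)"
    using norm_triangle_ineq[of a b] by simp
  then have "norm (a + b) powr p \<le> (2 * ((norm a + norm b) / 2)) powr p"
    using p by (intro powr_mono2) auto
  also have "\<dots> = 2 powr p * ((norm a + norm b) / 2) powr p"
    by (rule powr_mult) 
  also have "\<dots> \<le> 2 powr p * ((norm a powr p + norm b powr p) / 2)"
    using p by (intro mult_left_mono powr_midpoint_le) auto
  also have "\<dots> \<le> 2 powr p * (norm a powr p + norm b powr p)"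
    by (intro mult_left_mono) auto
  finally show ?thesis .
qed

section \<open>Lebesgue spaces\<close>

definition Lp_space :: "real \<Rightarrow> 'a measure \<Rightarrow> ('a \<Rightarrow> 'b::euclidean_space) set" where
  "Lp_space p M = {f \<in> borel_measurable M. integrable M (\<lambda>x. norm (f x) powr p)}"

text \<open>The p-th power of the distance in the Lebesgue norm. Without the root, pointwise
  inequalities between p-th powers can be integrated directly.\<close>

definition dist_powr :: "real \<Rightarrow> 'a measure \<Rightarrow> ('a \<Rightarrow> 'b::euclidean_space) \<Rightarrow> ('a \<Rightarrow> 'b) \<Rightarrow> real" where
  "dist_powr p M f g = (\<integral>x. norm (f x - g x) powr p \<partial>M)"

lemma Lp_space_measurable [measurable_dest]: "f \<in> Lp_space p M \<Longrightarrow> f \<in> borel_measurable M"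
  by (simp add: Lp_space_def)

lemma Lp_space_integrable: "f \<in> Lp_space p M \<Longrightarrow> integrable M (\<lambda>x. norm (f x) powr p)"
  by (simp add: Lp_space_def)

lemma Lp_space_scaleR:
  assumes "f \<in> Lp_space p M"
  shows "(\<lambda>x. c *\<^sub>R f x) \<in> Lp_space p M"
  using assms by (auto simp: Lp_space_def powr_mult)

lemma Lp_space_add:
  assumes "1 < p" and f: "f \<in> Lp_space p M" and g: "g \<in> Lp_space p M"
  shows "(\<lambda>x. f x + g x) \<in> Lp_space p M"
proof -
  note [measurable] = f g
  have "integrable M (\<lambda>x. 2 powr p * (norm (f x) powr p + norm (g x) powr p))"
    using f g by (intro integrable_mult_right Bochner_Integration.integrable_add Lp_space_integrable)
  then have "integrable M (\<lambda>x. norm (f x + g x) powr p)"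
    by (rule Bochner_Integration.integrable_bound) (auto simp: norm_add_powr_le[OF \<open>1 < p\<close>])
  then show ?thesis by (simp add: Lp_space_def)
qed

lemma Lp_space_diff:
  assumes "1 < p" "f \<in> Lp_space p M" "g \<in> Lp_space p M"
  shows "(\<lambda>x. f x - g x) \<in> Lp_space p M"
  using Lp_space_add[OF assms(1,2) Lp_space_scaleR[OF assms(3), of "-1"]] by simp

text \<open>Fatou's lemma for Bochner integrals: the convergent bounds \<open>B\<close> replace the
  limit inferior, and finiteness of the nonnegative integral yields integrability of the
  limit.\<close>

lemma Fatou_integral:
  fixes u :: "nat \<Rightarrow> 'a \<Rightarrow> real"
  assumes int: "\<And>n. integrable M (u n)" and nonneg: "\<And>n x. x \<in> space M \<Longrightarrow> 0 \<le> u n x"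
    and v: "v \<in> borel_measurable M" and lim: "AE x in M. (\<lambda>n. u n x) \<longlonglongrightarrow> v x"
    and bound: "\<And>n. (\<integral>x. u n x \<partial>M) \<le> B n" and B: "B \<longlonglongrightarrow> b"
  shows "integrable M v \<and> (\<integral>x. v x \<partial>M) \<le> b"
proof -
  note [measurable] = v borel_measurable_integrable[OF int]
  have v_nonneg: "AE x in M. 0 \<le> v x"
    using lim AE_space by eventually_elim (rule LIMSEQ_le_const, auto simp: nonneg)
  have "(\<integral>\<^sup>+x. ennreal (v x) \<partial>M) = (\<integral>\<^sup>+x. liminf (\<lambda>n. ennreal (u n x)) \<partial>M)"
    using lim by (intro nn_integral_cong_AE)
      (auto elim!: eventually_mono intro!: lim_imp_Liminf[symmetric] tendsto_ennrealI)
  also have "\<dots> \<le> liminf (\<lambda>n. \<integral>\<^sup>+x. ennreal (u n x) \<partial>M)"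
    by (rule nn_integral_liminf) auto
  also have "\<dots> = liminf (\<lambda>n. ennreal (\<integral>x. u n x \<partial>M))"
    by (subst nn_integral_eq_integral[OF int]) (auto simp: nonneg)
  also have "\<dots> \<le> liminf (\<lambda>n. ennreal (B n))"
    by (intro Liminf_mono always_eventually) (auto intro: ennreal_leI bound)
  also have "\<dots> = ennreal b"
    using B by (intro lim_imp_Liminf tendsto_ennrealI) auto
  finally have le: "(\<integral>\<^sup>+x. ennreal (v x) \<partial>M) \<le> ennreal b" .
  \<comment> \<open>\<open>ennreal\<close> sends negative reals to 0, so the estimate can be read
    back in the reals only once the sign of \<open>b\<close> is known.\<close>
  have b: "0 \<le> b"
  proof (rule LIMSEQ_le_const[OF B])
    show "\<exists>N. \<forall>n\<ge>N. 0 \<le> B n"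
      using order_trans[OF integral_nonneg_AE bound] nonneg by (intro exI allI impI) auto
  qed
  have "integrable M v"
    using v_nonneg by (intro integrableI_nonneg v le_less_trans[OF le]) auto
  moreover from this have "(\<integral>x. v x \<partial>M) \<le> b"
    using le b v_nonneg by (subst (asm) nn_integral_eq_integral) auto
  ultimately show ?thesis ..
qed

text \<open>By monotone convergence the integral of the sum is the sum of the integrals, hence
  finite; a function with finite integral is finite almost everywhere.\<close>

lemma AE_summable_of_integral_bound:
  fixes u :: "nat \<Rightarrow> 'a \<Rightarrow> real"
  assumes int: "\<And>n. integrable M (u n)" and nonneg: "\<And>n x. 0 \<le> u n x"
    and bound: "\<And>n. (\<integral>x. u n x \<partial>M) \<le> c n" and c: "summable c"
  shows "AE x in M. summable (\<lambda>n. u n x)"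
proof -
  note [measurable] = borel_measurable_integrable[OF int]
  have "(\<integral>\<^sup>+x. (\<Sum>n. ennreal (u n x)) \<partial>M) = (\<Sum>n. \<integral>\<^sup>+x. ennreal (u n x) \<partial>M)"
    by (rule nn_integral_suminf) auto
  also have "\<dots> = (\<Sum>n. ennreal (\<integral>x. u n x \<partial>M))"
    by (subst nn_integral_eq_integral[OF int]) (auto simp: nonneg)
  also have "\<dots> < \<top>"
  proof -
    have "summable (\<lambda>n. \<integral>x. u n x \<partial>M)"
      by (rule summable_comparison_test'[OF c, of 0]) (auto simp: nonneg bound)
    then show ?thesis
      by (subst suminf_ennreal2) (auto simp: nonneg)
  qed
  finally have "AE x in M. (\<Sum>n. ennreal (u n x)) \<noteq> \<infinity>"
    by (intro nn_integral_noteq_infinite) auto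
  then show ?thesis
    by eventually_elim (rule summable_suminf_not_top, auto simp: nonneg)
qed

text \<open>The series of \<open>4\<^sup>p\<^sup>k |f\<^sub>k\<^sub>+\<^sub>1 - f\<^sub>k|\<^sup>p\<close> converges almost everywhere, so that
  the increments are eventually at most \<open>4\<^sup>-\<^sup>k\<close>.\<close>
lemma AE_convergent_of_fast:
  fixes f :: "nat \<Rightarrow> 'a \<Rightarrow> 'b::euclidean_space"
  assumes p: "1 < p" and f: "\<And>n. f n \<in> Lp_space p M"
    and fast: "\<And>n. dist_powr p M (f (Suc n)) (f n) \<le> (1 / 4 powr (real n * p)) * (1 / 2 ^ n)"
  shows "AE x in M. convergent (\<lambda>n. f n x)"
proof -
  define u where "u n x = 4 powr (real n * p) * norm (f (Suc n) x - f n x) powr p" for n x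
  have "AE x in M. summable (\<lambda>n. u n x)"
  proof (rule AE_summable_of_integral_bound)
    show "integrable M (u n)" for n
      unfolding u_def by (intro integrable_mult_right Lp_space_integrable Lp_space_diff p f)
    have "(\<integral>x. u n x \<partial>M) = 4 powr (real n * p) * dist_powr p M (f (Suc n)) (f n)" for n
      by (simp add: u_def dist_powr_def)
    \<comment> \<open>The weight in \<open>u\<close> cancels the first factor of
      \<open>fast\<close>; the second factor is geometric and makes the integrals summable.\<close>
    also have "\<dots> n \<le> (1 / 2) ^ n" for n
      using mult_left_mono[OF fast[of n], of "4 powr (real n * p)"] by (simp add: power_one_over)
    finally show "(\<integral>x. u n x \<partial>M) \<le> (1 / 2) ^ n" for n .
  qed (auto simp: u_def summable_geometric)
  then show ?thesis
  proof eventually_elim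
    case (elim x)
    have "\<forall>\<^sub>F n in sequentially. u n x < 1"
      using order_tendstoD(2)[OF summable_LIMSEQ_zero[OF elim]] by simp
    then have ev: "\<forall>\<^sub>F n in sequentially. norm (f (Suc n) x - f n x) \<le> (1 / 4) ^ n"
    proof eventually_elim
      case (elim n)
      \<comment> \<open>The weight is itself a p-th power, so \<open>u n x < 1\<close> bounds the
        base, that is, \<open>4 ^ n\<close> times the increment.\<close>
      have "u n x = (4 ^ n * norm (f (Suc n) x - f n x)) powr p"
        by (simp add: u_def powr_mult powr_powr[symmetric] powr_realpow)
      with elim have "4 ^ n * norm (f (Suc n) x - f n x) < 1"
        using p ge_one_powr_ge_zero[of "4 ^ n * norm (f (Suc n) x - f n x)" p] by linarith
      then show ?case by (simp add: field_simps power_one_over)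
    qed
    have "summable (\<lambda>n. f (Suc n) x - f n x)"
      by (rule summable_comparison_test_ev[OF ev]) (simp add: summable_geometric)
    then have "convergent (\<lambda>n. \<Sum>k<n. f (Suc k) x - f k x)"
      by (simp add: summable_iff_convergent)
    then have "convergent (\<lambda>n. f n x - f 0 x)"
      by (simp only: sum_lessThan_telescope[of "\<lambda>n. f n x"])
    from convergent_add[OF this convergent_const[of "f 0 x"]] show ?case
      by simp
  qed
qed

text \<open>Riesz-Fischer. Both modes of convergence are kept: convergence almost everywhere feeds
  Fatou's lemma for the energies, convergence in the Lebesgue norm feeds the pairings with test
  functions.\<close>

lemma Lp_space_complete:
  fixes f :: "nat \<Rightarrow> 'a \<Rightarrow> 'b::euclidean_space"
  assumes p: "1 < p" and f: "\<And>n. f n \<in> Lp_space p M"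
    and cauchy: "\<And>e. 0 < e \<Longrightarrow> \<exists>N. \<forall>m\<ge>N. \<forall>n\<ge>N. dist_powr p M (f m) (f n) \<le> e"
  obtains r g where "strict_mono r" "g \<in> Lp_space p M" "AE x in M. (\<lambda>k. f (r k) x) \<longlonglongrightarrow> g x"
    "(\<lambda>k. dist_powr p M (f (r k)) g) \<longlonglongrightarrow> 0"
proof -
  define e where "e k = (1 / 4 powr (real k * p)) * (1 / 2 ^ k)" for k
  have "\<exists>N. \<forall>m\<ge>N. \<forall>n\<ge>N. dist_powr p M (f m) (f n) \<le> e k" for k
    by (rule cauchy) (simp add: e_def)
  then obtain N where N: "\<And>k m n. N k \<le> m \<Longrightarrow> N k \<le> n \<Longrightarrow> dist_powr p M (f m) (f n) \<le> e k"
    by metis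
  \<comment> \<open>The sum puts \<open>r k\<close> above \<open>N k\<close>, and the summand
    \<open>k\<close> makes the sequence strictly increasing.\<close>
  define r where "r k = (\<Sum>i\<le>k. N i) + k" for k
  have r: "strict_mono r"
    by (intro strict_monoI_Suc) (simp add: r_def)
  have N_le: "N k \<le> r k" for k
    using member_le_sum[of k "{..k}" N] by (simp add: r_def)
  have r_Suc: "r k \<le> r (Suc k)" for k
    using r by (simp add: strict_mono_less_eq)
  have conv: "AE x in M. convergent (\<lambda>k. f (r k) x)"
  proof (rule AE_convergent_of_fast[OF p])
    show "dist_powr p M (f (r (Suc k))) (f (r k)) \<le> 1 / 4 powr (real k * p) * (1 / 2 ^ k)" for k
      using N[of k "r (Suc k)" "r k"] N_le[of k] r_Suc[of k] by (simp add: e_def)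
  qed (rule f)
  note [measurable] = f
  define g where "g x = lim (\<lambda>k. f (r k) x)" for x
  have g [measurable]: "g \<in> borel_measurable M"
    unfolding g_def by (rule borel_measurable_lim_metric) measurable
  have lim: "AE x in M. (\<lambda>k. f (r k) x) \<longlonglongrightarrow> g x"
    using conv by eventually_elim (simp add: g_def convergent_LIMSEQ_iff)
  \<comment> \<open>Fatou's lemma in the second index, with \<open>f n\<close> held fixed, transfers
    a Cauchy bound to the limit. The shift by \<open>M0\<close> makes all indices large enough. The
    integrability obtained here also puts \<open>g\<close> into the space, as a difference of two of
    its members.\<close>
  have close: "integrable M (\<lambda>x. norm (f n x - g x) powr p) \<and> dist_powr p M (f n) g \<le> c"
    if n: "\<And>m. M0 \<le> m \<Longrightarrow> dist_powr p M (f n) (f m) \<le> c" for n c M0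
    unfolding dist_powr_def
  proof (rule Fatou_integral[where u = "\<lambda>k x. norm (f n x - f (r (k + M0)) x) powr p" and B = "\<lambda>k. c"])
    show "AE x in M. (\<lambda>k. norm (f n x - f (r (k + M0)) x) powr p) \<longlonglongrightarrow> norm (f n x - g x) powr p"
      using lim
    proof eventually_elim
      case (elim x)
      then have "(\<lambda>k. f (r (k + M0)) x) \<longlonglongrightarrow> g x"
        by (rule LIMSEQ_ignore_initial_segment)
      then show ?case using p by (intro tendsto_powr' tendsto_intros) auto
    qed
    have "M0 \<le> r (k + M0)" for k
      using seq_suble[OF r, of "k + M0"] by simp
    then show "(\<integral>x. norm (f n x - f (r (k + M0)) x) powr p \<partial>M) \<le> c" for k
      using n unfolding dist_powr_def by blast
  qed (use p in \<open>auto intro!: Lp_space_integrable Lp_space_diff f\<close>)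
  have gL: "g \<in> Lp_space p M"
  proof -
    have "integrable M (\<lambda>x. norm (f (N 0) x - g x) powr p)"
      using close[of "N 0" "N 0" "e 0"] N[of 0 "N 0"] by blast
    then have "(\<lambda>x. f (N 0) x - g x) \<in> Lp_space p M"
      by (simp add: Lp_space_def)
    from Lp_space_diff[OF p f[of "N 0"] this] show ?thesis by simp
  qed
  have "(\<lambda>n. dist_powr p M (f n) g) \<longlonglongrightarrow> 0"
  proof (rule LIMSEQ_I)
    fix c :: real assume "0 < c"
    then obtain N' where N': "\<forall>m\<ge>N'. \<forall>n\<ge>N'. dist_powr p M (f m) (f n) \<le> c / 2"
      using cauchy[of "c / 2"] by auto
    have "norm (dist_powr p M (f n) g - 0) < c" if "N' \<le> n" for n
    proof -
      have "0 \<le> dist_powr p M (f n) g" by (simp add: dist_powr_def)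
      moreover have "dist_powr p M (f n) g \<le> c / 2"
        using close[of N' n "c / 2"] N' that by blast
      ultimately show ?thesis using \<open>0 < c\<close> by simp
    qed
    then show "\<exists>no. \<forall>n\<ge>no. norm (dist_powr p M (f n) g - 0) < c" by blast
  qed
  then have "(\<lambda>k. dist_powr p M (f (r k)) g) \<longlonglongrightarrow> 0"
    using LIMSEQ_subseq_LIMSEQ[OF _ r] by (auto simp: o_def)
  with that r gL lim show ?thesis by blast
qed

section \<open>Pairing with the conjugate exponent\<close>

lemma conj_exp_props:
  assumes "1 < p"
  shows "1 < conj_exp p" "1 / p + 1 / conj_exp p = 1"
  using assms by (auto simp: conj_exp_def field_simps)

text \<open>Young's inequality with a free weight \<open>t\<close>, the factors \<open>1 / p\<close>
  and \<open>1 / conj_exp p\<close> being bounded by 1. A small \<open>t\<close> makes the second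
  term small at the expense of the first; \<open>t = 1\<close> suffices for integrability.\<close>

lemma inner_powr_bound:
  fixes a b :: "'b::euclidean_space"
  assumes p: "1 < p" and t: "0 < t"
  shows "\<bar>a \<bullet> b\<bar> \<le> (1 / t) powr p * norm a powr p + t powr conj_exp p * norm b powr conj_exp p"
proof -
  have "\<bar>a \<bullet> b\<bar> \<le> norm a * norm b" by (rule Cauchy_Schwarz_ineq2)
  also have "\<dots> = (norm a / t) * (t * norm b)" using t by simp
  also have "\<dots> \<le> (norm a / t) powr p / p + (t * norm b) powr conj_exp p / conj_exp p"
    using p t conj_exp_props[OF p] by (intro Youngs_inequality) auto
  also have "\<dots> \<le> (norm a / t) powr p + (t * norm b) powr conj_exp p"
    using p conj_exp_props[OF p] by (intro add_mono) (auto simp: divide_le_eq mult_le_cancel_left1)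
  also have "(norm a / t) powr p = (1 / t) powr p * norm a powr p"
    using powr_mult[of "1 / t" "norm a" p] by (simp add: mult.commute)
  also have "(t * norm b) powr conj_exp p = t powr conj_exp p * norm b powr conj_exp p"
    by (rule powr_mult)
  finally show ?thesis .
qed

lemma Lp_pairing_integrable:
  fixes f g :: "'a \<Rightarrow> 'b::euclidean_space"
  assumes p: "1 < p" and f: "f \<in> Lp_space p M" and g: "g \<in> Lp_space (conj_exp p) M"
  shows "integrable M (\<lambda>x. f x \<bullet> g x)"
proof (rule Bochner_Integration.integrable_bound)
  note [measurable] = f g
  show "integrable M (\<lambda>x. norm (f x) powr p + norm (g x) powr conj_exp p)"
    using f g by (intro Bochner_Integration.integrable_add Lp_space_integrable)
  show "(\<lambda>x. f x \<bullet> g x) \<in> borel_measurable M" by measurable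
  show "AE x in M. norm (f x \<bullet> g x) \<le> norm (norm (f x) powr p + norm (g x) powr conj_exp p)"
    using inner_powr_bound[OF p, of 1] by (intro AE_I2) simp
qed

lemma Lp_pairing_tendsto:
  fixes f :: "nat \<Rightarrow> 'a \<Rightarrow> 'b::euclidean_space"
  assumes p: "1 < p" and f: "\<And>n. f n \<in> Lp_space p M" and h: "h \<in> Lp_space p M"
    and lim: "(\<lambda>n. dist_powr p M (f n) h) \<longlonglongrightarrow> 0" and g: "g \<in> Lp_space (conj_exp p) M"
  shows "(\<lambda>n. \<integral>x. f n x \<bullet> g x \<partial>M) \<longlonglongrightarrow> (\<integral>x. h x \<bullet> g x \<partial>M)"
proof (rule LIMSEQ_I)
  fix e :: real assume e: "0 < e"
  define q where "q = conj_exp p"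
  define G where "G = (\<integral>x. norm (g x) powr q \<partial>M)"
  have G: "0 \<le> G" by (simp add: G_def)
  \<comment> \<open>Chosen so that \<open>t powr q * G\<close> stays below \<open>e / 2\<close>;
    adding 1 to \<open>G\<close> covers the case in which \<open>g\<close> vanishes almost
    everywhere. With \<open>t\<close> fixed, the other term of the bound tends to 0.\<close>
  define t where "t = (e / (2 * (G + 1))) powr (1 / q)"
  have q: "1 < q" using conj_exp_props[OF p] by (simp add: q_def)
  have t: "0 < t" using e G by (simp add: t_def)
  have "t powr q = e / (2 * (G + 1))"
    using e G q by (simp add: t_def powr_powr)
  moreover have "e / (2 * (G + 1)) * G < e / 2"
    using e G by (simp add: field_simps)
  ultimately have tG: "t powr q * G < e / 2" by simp
  have bound: "\<bar>(\<integral>x. f n x \<bullet> g x \<partial>M) - (\<integral>x. h x \<bullet> g x \<partial>M)\<bar>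
      \<le> (1 / t) powr p * dist_powr p M (f n) h + t powr q * G" for n
  proof -
    have d: "(\<lambda>x. f n x - h x) \<in> Lp_space p M" by (rule Lp_space_diff[OF p f h])
    have "(\<integral>x. f n x \<bullet> g x \<partial>M) - (\<integral>x. h x \<bullet> g x \<partial>M) = (\<integral>x. (f n x - h x) \<bullet> g x \<partial>M)"
      using Lp_pairing_integrable[OF p f[of n] g] Lp_pairing_integrable[OF p h g]
      by (simp add: inner_diff_left)
    also have "\<bar>\<dots>\<bar> \<le> (\<integral>x. \<bar>(f n x - h x) \<bullet> g x\<bar> \<partial>M)"
      by (rule integral_abs_bound)
    also have "\<dots> \<le> (\<integral>x. (1 / t) powr p * norm (f n x - h x) powr p + t powr q * norm (g x) powr q \<partial>M)"
      using Lp_pairing_integrable[OF p d g] Lp_space_integrable[OF d] Lp_space_integrable[OF g]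
        inner_powr_bound[OF p t]
      by (intro integral_mono) (auto simp: q_def)
    also have "\<dots> = (1 / t) powr p * dist_powr p M (f n) h + t powr q * G"
      using Lp_space_integrable[OF d] Lp_space_integrable[OF g]
      by (simp add: dist_powr_def G_def q_def)
    finally show ?thesis .
  qed
  have "(\<lambda>n. (1 / t) powr p * dist_powr p M (f n) h) \<longlonglongrightarrow> 0"
    using tendsto_mult_left[OF lim, of "(1 / t) powr p"] by simp
  then have "\<forall>\<^sub>F n in sequentially. (1 / t) powr p * dist_powr p M (f n) h < e / 2"
    using e by (intro order_tendstoD(2)) auto
  then have "\<forall>\<^sub>F n in sequentially. norm ((\<integral>x. f n x \<bullet> g x \<partial>M) - (\<integral>x. h x \<bullet> g x \<partial>M)) < e"
  proof eventually_elim
    case (elim n)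
    with bound[of n] tG show ?case by simp
  qed
  then show "\<exists>no. \<forall>n\<ge>no. norm ((\<integral>x. f n x \<bullet> g x \<partial>M) - (\<integral>x. h x \<bullet> g x \<partial>M)) < e"
    by (simp add: eventually_sequentially)
qed

section \<open>Minimizing sequences\<close>

lemma powr_le_one_add_powr:
  fixes t a b :: real
  assumes "0 \<le> t" "0 \<le> a" "a \<le> b"
  shows "t powr a \<le> 1 + t powr b"
proof (cases "t \<le> 1")
  case True
  then have "t powr a \<le> 1" using assms by (intro powr_le1) auto
  then show ?thesis using powr_ge_zero[of t b] by linarith
next
  case False
  then have "t powr a \<le> t powr b" using assms by (intro powr_mono) auto
  then show ?thesis by linarith
qed

lemma Lp_space_norm_integrable:
  assumes "finite_measure M" and p: "1 < p" and f: "f \<in> Lp_space p M"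
  shows "integrable M (\<lambda>x. norm (f x))"
proof (rule Bochner_Integration.integrable_bound)
  interpret finite_measure M by fact
  note [measurable] = f
  show "integrable M (\<lambda>x. 1 + norm (f x) powr p)"
    using f by (intro Bochner_Integration.integrable_add Lp_space_integrable) auto
  show "(\<lambda>x. norm (f x)) \<in> borel_measurable M" by measurable
  show "AE x in M. norm (norm (f x)) \<le> norm (1 + norm (f x) powr p)"
  proof (intro AE_I2)
    fix x
    have "norm (f x) \<le> 1 + norm (f x) powr p"
      using powr_le_one_add_powr[of "norm (f x)" 1 p] p by simp
    then show "norm (norm (f x)) \<le> norm (1 + norm (f x) powr p)" by simp
  qed
qed

text \<open>The integrand of the regularized Beckmann problem, with \<open>e\<close> standing for
  \<epsilon>/\<alpha>.\<close>

definition growth_integrand :: "real \<Rightarrow> real \<Rightarrow> ('a \<Rightarrow> real) \<Rightarrow> 'a \<Rightarrow> 'b::euclidean_space \<Rightarrow> real" where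
  "growth_integrand p e w x v = w x * norm v + e * norm v powr p"

definition growth_energy :: "real \<Rightarrow> real \<Rightarrow> ('a \<Rightarrow> real) \<Rightarrow> 'a measure \<Rightarrow> ('a \<Rightarrow> 'b::euclidean_space) \<Rightarrow> real" where
  "growth_energy p e w M f = (\<integral>x. growth_integrand p e w x (f x) \<partial>M)"

text \<open>Nonnegativity of \<open>w\<close> makes the weighted norm convex and bounded below, the
  bound \<open>W\<close> makes it integrable on the Lebesgue space, and \<open>e > 0\<close>
  provides coercivity even where \<open>w\<close> vanishes.\<close>

locale growth_functional = finite_measure M
  for M :: "'a measure" +
  fixes p e W :: real and w :: "'a \<Rightarrow> real"
  assumes p: "1 < p" and e: "0 < e"
    and w_measurable [measurable]: "w \<in> borel_measurable M"
    and w_nonneg: "\<And>x. x \<in> space M \<Longrightarrow> 0 \<le> w x"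
    and w_le: "\<And>x. x \<in> space M \<Longrightarrow> w x \<le> W"
begin

lemma weighted_norm_integrable:
  assumes f: "f \<in> Lp_space p M"
  shows "integrable M (\<lambda>x. w x * norm (f x))"
proof (rule Bochner_Integration.integrable_bound)
  note [measurable] = f
  show "integrable M (\<lambda>x. W * norm (f x))"
    using Lp_space_norm_integrable[OF finite_measure_axioms p f] by simp
  show "(\<lambda>x. w x * norm (f x)) \<in> borel_measurable M" by measurable
  show "AE x in M. norm (w x * norm (f x)) \<le> norm (W * norm (f x))"
  proof (intro AE_I2)
    fix x assume x: "x \<in> space M"
    have "w x * norm (f x) \<le> W * norm (f x)" "0 \<le> w x * norm (f x)"
      using w_nonneg[OF x] w_le[OF x] by (auto intro: mult_right_mono)
    then show "norm (w x * norm (f x)) \<le> norm (W * norm (f x))"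
      by simp
  qed
qed

lemma growth_integrand_integrable:
  assumes f: "f \<in> Lp_space p M"
  shows "integrable M (\<lambda>x. growth_integrand p e w x (f x))"
  unfolding growth_integrand_def
  using weighted_norm_integrable[OF f] Lp_space_integrable[OF f] by simp

lemma growth_integrand_nonneg: "x \<in> space M \<Longrightarrow> 0 \<le> growth_integrand p e w x v"
  using w_nonneg e by (simp add: growth_integrand_def)

lemma growth_energy_nonneg: "0 \<le> growth_energy p e w M f"
  unfolding growth_energy_def by (intro integral_nonneg_AE AE_I2 growth_integrand_nonneg)

text \<open>Coercivity: the weighted norm is nonnegative and may be dropped.\<close>

lemma integral_powr_le_growth_energy:
  assumes f: "f \<in> Lp_space p M"
  shows "e * (\<integral>x. norm (f x) powr p \<partial>M) \<le> growth_energy p e w M f"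
proof -
  have "(\<integral>x. e * norm (f x) powr p \<partial>M) \<le> growth_energy p e w M f"
    unfolding growth_energy_def using growth_integrand_integrable[OF f] Lp_space_integrable[OF f] w_nonneg
    by (intro integral_mono) (auto simp: growth_integrand_def)
  then show ?thesis by simp
qed

text \<open>The gap comes from the power term alone. The weighted norm is midpoint convex, so its
  own defect has the right sign and is discarded.\<close>

lemma midpoint_gap_integral_le:
  assumes f: "f \<in> Lp_space p M" and g: "g \<in> Lp_space p M"
  shows "integrable M (\<lambda>x. midpoint_gap p (f x) (g x))"
    and "e * (\<integral>x. midpoint_gap p (f x) (g x) \<partial>M) \<le>
      (growth_energy p e w M f + growth_energy p e w M g) / 2
        - growth_energy p e w M (\<lambda>x. (1 / 2) *\<^sub>R (f x + g x))"
proof -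
  define h where "h x = (1 / 2) *\<^sub>R (f x + g x)" for x
  have h: "h \<in> Lp_space p M"
    unfolding h_def by (intro Lp_space_scaleR Lp_space_add p f g)
  show gap: "integrable M (\<lambda>x. midpoint_gap p (f x) (g x))"
    unfolding midpoint_gap_def h_def[symmetric]
    using Lp_space_integrable[OF f] Lp_space_integrable[OF g] Lp_space_integrable[OF h] by simp
  have "e * (\<integral>x. midpoint_gap p (f x) (g x) \<partial>M) + growth_energy p e w M h
    = (\<integral>x. e * midpoint_gap p (f x) (g x) + growth_integrand p e w x (h x) \<partial>M)"
    unfolding growth_energy_def using gap growth_integrand_integrable[OF h] by simp
  also have "\<dots> \<le> (\<integral>x. (growth_integrand p e w x (f x) + growth_integrand p e w x (g x)) / 2 \<partial>M)"
  proof (rule integral_mono)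
    fix x assume x: "x \<in> space M"
    have "w x * norm (h x) \<le> w x * ((norm (f x) + norm (g x)) / 2)"
      unfolding h_def using w_nonneg[OF x] by (rule mult_left_mono[OF norm_midpoint_le])
    then show "e * midpoint_gap p (f x) (g x) + growth_integrand p e w x (h x)
      \<le> (growth_integrand p e w x (f x) + growth_integrand p e w x (g x)) / 2"
      unfolding midpoint_gap_def h_def[symmetric] growth_integrand_def
      by (simp add: field_simps)
  qed (use gap growth_integrand_integrable[OF f] growth_integrand_integrable[OF g]
        growth_integrand_integrable[OF h] in auto)
  also have "\<dots> = (growth_energy p e w M f + growth_energy p e w M g) / 2"
    unfolding growth_energy_def
    using growth_integrand_integrable[OF f] growth_integrand_integrable[OF g] by simp
  finally show "e * (\<integral>x. midpoint_gap p (f x) (g x) \<partial>M) \<le>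
      (growth_energy p e w M f + growth_energy p e w M g) / 2
        - growth_energy p e w M (\<lambda>x. (1 / 2) *\<^sub>R (f x + g x))"
    unfolding h_def by linarith
qed

text \<open>Two members with energy at most \<open>I + k\<close> have a midpoint in
  \<open>A\<close>, whose energy is at least the infimum \<open>I\<close>; hence the integral of
  their gap is at most \<open>k / e\<close>. Integrating the pointwise bound on
  \<open>norm (a - b) powr p\<close> then controls the distance. The constants are fixed in the
  order \<open>B\<close>, \<eta>, \<open>C\<close>, \<open>k\<close>, as each depends on the
  previous ones.\<close>

lemma minimizing_sequence_cauchy:
  fixes f :: "nat \<Rightarrow> 'a \<Rightarrow> 'b::euclidean_space"
  assumes A: "A \<subseteq> Lp_space p M"
    and mid: "\<And>h g. h \<in> A \<Longrightarrow> g \<in> A \<Longrightarrow> (\<lambda>x. (1 / 2) *\<^sub>R (h x + g x)) \<in> A"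
    and f: "\<And>n. f n \<in> A"
    and minimizing: "\<And>h c. h \<in> A \<Longrightarrow> 0 < c \<Longrightarrow>
      \<forall>\<^sub>F n in sequentially. growth_energy p e w M (f n) \<le> growth_energy p e w M h + c"
    and c: "0 < c"
  shows "\<exists>N. \<forall>m\<ge>N. \<forall>n\<ge>N. dist_powr p M (f m) (f n) \<le> c"
proof -
  let ?E = "growth_energy p e w M :: ('a \<Rightarrow> 'b) \<Rightarrow> real"
  define I where "I = (INF h\<in>A. ?E h)"
  have bdd: "bdd_below (?E ` A)"
    using growth_energy_nonneg by (intro bdd_belowI[of _ 0]) auto
  have I_le: "I \<le> ?E h" if "h \<in> A" for h
    unfolding I_def by (rule cINF_lower[OF bdd that])
  have ev: "\<forall>\<^sub>F n in sequentially. ?E (f n) \<le> I + k" if "0 < k" for k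
  proof -
    have "\<exists>h\<in>A. ?E h < I + k / 2"
      unfolding I_def using f bdd that by (subst cINF_less_iff[symmetric]) auto
    then obtain h where h: "h \<in> A" "?E h < I + k / 2" by blast
    have "\<forall>\<^sub>F n in sequentially. ?E (f n) \<le> ?E h + k / 2"
      using minimizing[OF h(1)] that by simp
    then show ?thesis
      by (rule eventually_mono) (use h(2) in linarith)
  qed
  have I: "0 \<le> I"
    unfolding I_def using f growth_energy_nonneg by (intro cINF_greatest) auto
  \<comment> \<open>Since \<open>k\<close> will be at most 1, late members have energy at most
    \<open>I + 1\<close>, and coercivity bounds the integrals of their p-th powers by
    \<open>B\<close>.\<close>
  define B where "B = (I + 1) / e"
  have B: "0 \<le> B" using I e by (simp add: B_def)
  \<comment> \<open>Makes \<open>\<eta> * (2 * B)\<close> at most \<open>c / 2\<close>; the choice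
    of \<open>k\<close> below gives the other half.\<close>
  define \<eta> where "\<eta> = c / (4 * (B + 1))"
  have eta: "0 < \<eta>" using c B by (simp add: \<eta>_def)
  obtain C where C: "0 \<le> C" "\<And>a b :: 'b. norm (a - b) powr p
      \<le> \<eta> * (norm a powr p + norm b powr p) + C * midpoint_gap p a b"
    using norm_diff_powr_le_midpoint_gap[OF p eta] by blast
  define k where "k = min 1 (e * c / (2 * (C + 1)))"
  have k: "0 < k" using e c C by (simp add: k_def)
  obtain N where N: "\<And>n. N \<le> n \<Longrightarrow> ?E (f n) \<le> I + k"
    using ev[OF k] by (auto simp: eventually_sequentially)
  have "dist_powr p M (f m) (f n) \<le> c" if m: "N \<le> m" and n: "N \<le> n" for m n
  proof -
    have fL: "f j \<in> Lp_space p M" for j using A f by blast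
    have bound: "(\<integral>x. norm (f j x) powr p \<partial>M) \<le> B" if "N \<le> j" for j
    proof -
      have "e * (\<integral>x. norm (f j x) powr p \<partial>M) \<le> I + 1"
        using integral_powr_le_growth_energy[OF fL[of j]] N[OF that] by (simp add: k_def)
      then show ?thesis using e by (simp add: B_def field_simps)
    qed
    note gap = midpoint_gap_integral_le[OF fL[of m] fL[of n]]
    have "(?E (f m) + ?E (f n)) / 2 \<le> I + k"
      using N[OF m] N[OF n] by simp
    with gap(2) I_le[OF mid[OF f[of m] f[of n]]]
    have "e * (\<integral>x. midpoint_gap p (f m x) (f n x) \<partial>M) \<le> k"
      by linarith
    then have "(\<integral>x. midpoint_gap p (f m x) (f n x) \<partial>M) \<le> k / e"
      using e by (simp add: field_simps)
    also have "\<dots> \<le> (e * c / (2 * (C + 1))) / e"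
      using e by (intro divide_right_mono) (auto simp: k_def)
    also have "\<dots> = c / (2 * (C + 1))"
      using e by simp
    finally have "C * (\<integral>x. midpoint_gap p (f m x) (f n x) \<partial>M) \<le> C * (c / (2 * (C + 1)))"
      using C(1) by (intro mult_left_mono)
    also have "\<dots> \<le> c / 2"
      using C(1) c by (simp add: field_simps)
    finally have 1: "C * (\<integral>x. midpoint_gap p (f m x) (f n x) \<partial>M) \<le> c / 2" .
    have "\<eta> * ((\<integral>x. norm (f m x) powr p \<partial>M) + (\<integral>x. norm (f n x) powr p \<partial>M)) \<le> \<eta> * (2 * B)"
      using bound[OF m] bound[OF n] eta by (intro mult_left_mono) auto
    also have "\<dots> \<le> c / 2"
      using B c by (simp add: \<eta>_def field_simps)
    finally have 2: "\<eta> * ((\<integral>x. norm (f m x) powr p \<partial>M) + (\<integral>x. norm (f n x) powr p \<partial>M)) \<le> c / 2" .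
    have "dist_powr p M (f m) (f n)
      \<le> (\<integral>x. \<eta> * (norm (f m x) powr p + norm (f n x) powr p) + C * midpoint_gap p (f m x) (f n x) \<partial>M)"
      unfolding dist_powr_def using C(2) gap(1) Lp_space_integrable[OF fL] Lp_space_integrable[OF Lp_space_diff[OF p fL fL]]
      by (intro integral_mono) auto
    also have "\<dots> = \<eta> * ((\<integral>x. norm (f m x) powr p \<partial>M) + (\<integral>x. norm (f n x) powr p \<partial>M))
        + C * (\<integral>x. midpoint_gap p (f m x) (f n x) \<partial>M)"
      using gap(1) Lp_space_integrable[OF fL] by simp
    finally show ?thesis using 1 2 by linarith
  qed
  then show ?thesis by blast
qed

text \<open>Fatou's lemma along the subsequence gives lower semicontinuity of the energy. The limit
  is compared with every member of \<open>A\<close> without being claimed to lie in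
  \<open>A\<close>, because no closedness of \<open>A\<close> is assumed here.\<close>

lemma minimizing_sequence_convergent:
  fixes f :: "nat \<Rightarrow> 'a \<Rightarrow> 'b::euclidean_space"
  assumes A: "A \<subseteq> Lp_space p M"
    and mid: "\<And>h g. h \<in> A \<Longrightarrow> g \<in> A \<Longrightarrow> (\<lambda>x. (1 / 2) *\<^sub>R (h x + g x)) \<in> A"
    and f: "\<And>n. f n \<in> A"
    and minimizing: "\<And>h c. h \<in> A \<Longrightarrow> 0 < c \<Longrightarrow>
      \<forall>\<^sub>F n in sequentially. growth_energy p e w M (f n) \<le> growth_energy p e w M h + c"
  obtains r g where "strict_mono r" "g \<in> Lp_space p M"
    "(\<lambda>k. dist_powr p M (f (r k)) g) \<longlonglongrightarrow> 0"
    "\<And>h. h \<in> A \<Longrightarrow> growth_energy p e w M g \<le> growth_energy p e w M h"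
proof -
  have fL: "f n \<in> Lp_space p M" for n using A f by blast
  obtain r g where r: "strict_mono r" and g: "g \<in> Lp_space p M"
    and lim: "AE x in M. (\<lambda>k. f (r k) x) \<longlonglongrightarrow> g x"
    and dist: "(\<lambda>k. dist_powr p M (f (r k)) g) \<longlonglongrightarrow> 0"
    using Lp_space_complete[OF p fL minimizing_sequence_cauchy[OF A mid f minimizing]] by blast
  have "growth_energy p e w M g \<le> growth_energy p e w M h" if h: "h \<in> A" for h
  proof (rule field_le_epsilon)
    fix c :: real assume "0 < c"
    then obtain N where N: "\<And>n. N \<le> n \<Longrightarrow> growth_energy p e w M (f n) \<le> growth_energy p e w M h + c"
      using minimizing[OF h] by (auto simp: eventually_sequentially)
    show "growth_energy p e w M g \<le> growth_energy p e w M h + c"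
      unfolding growth_energy_def[of p e w M g]
    proof (rule conjunct2[OF Fatou_integral[where u = "\<lambda>k x. growth_integrand p e w x (f (r (k + N)) x)"
          and B = "\<lambda>k. growth_energy p e w M h + c"]])
      show "AE x in M. (\<lambda>k. growth_integrand p e w x (f (r (k + N)) x)) \<longlonglongrightarrow> growth_integrand p e w x (g x)"
        using lim
      proof eventually_elim
        case (elim x)
        then have "(\<lambda>k. f (r (k + N)) x) \<longlonglongrightarrow> g x"
          by (rule LIMSEQ_ignore_initial_segment)
        then show ?case
          unfolding growth_integrand_def using p by (intro tendsto_intros tendsto_powr') auto
      qed
      \<comment> \<open>\<open>Fatou_integral\<close> asks for the bound at every index, so the
        subsequence is started late enough for the energy estimate to hold throughout.\<close>
      have "N \<le> r (k + N)" for k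
        using seq_suble[OF r, of "k + N"] by simp
      then show "(\<integral>x. growth_integrand p e w x (f (r (k + N)) x) \<partial>M) \<le> growth_energy p e w M h + c" for k
        using N unfolding growth_energy_def by blast
      show "(\<lambda>x. growth_integrand p e w x (g x)) \<in> borel_measurable M"
        by (rule borel_measurable_integrable[OF growth_integrand_integrable[OF g]])
    qed (auto intro: growth_integrand_integrable fL growth_integrand_nonneg)
  qed
  with that r g dist show ?thesis by blast
qed

text \<open>Coercivity turns the error bound into \<open>E (f n) (1 - \<kappa> n / e) \<le> E h + o(1)\<close>.\<close>
lemma minimizers_of_perturbations_minimizing:
  fixes f :: "nat \<Rightarrow> 'a \<Rightarrow> 'b::euclidean_space"
  assumes A: "A \<subseteq> Lp_space p M" and f: "\<And>n. f n \<in> A"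
    and min: "\<And>n h. h \<in> A \<Longrightarrow> J n (f n) \<le> J n h"
    and err: "\<And>n h. h \<in> A \<Longrightarrow>
      \<bar>J n h - growth_energy p e w M h\<bar> \<le> \<kappa> n * (m + (\<integral>x. norm (h x) powr p \<partial>M))"
    and kappa: "\<And>n. 0 \<le> \<kappa> n" "\<kappa> \<longlonglongrightarrow> 0"
    and h: "h \<in> A" and c: "0 < c"
  shows "\<forall>\<^sub>F n in sequentially. growth_energy p e w M (f n) \<le> growth_energy p e w M h + c"
proof -
  let ?E = "growth_energy p e w M :: ('a \<Rightarrow> 'b) \<Rightarrow> real"
  let ?N = "\<lambda>h :: 'a \<Rightarrow> 'b. \<integral>x. norm (h x) powr p \<partial>M"
  \<comment> \<open>The bound found by solving the perturbed inequality for \<open>?E (f n)\<close>.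
    One \<open>m\<close> comes from the error at \<open>f n\<close> and one from the error at
    \<open>h\<close>; the denominator arises when the p-th power of \<open>f n\<close> is absorbed
    by coercivity.\<close>
  define b where "b n = (?E h + \<kappa> n * (2 * m + ?N h)) / (1 - \<kappa> n / e)" for n
  have "b \<longlonglongrightarrow> (?E h + 0 * (2 * m + ?N h)) / (1 - 0 / e)"
    unfolding b_def using e by (intro tendsto_intros kappa) auto
  then have "\<forall>\<^sub>F n in sequentially. b n < ?E h + c"
    using c by (intro order_tendstoD(2)) auto
  moreover have "\<forall>\<^sub>F n in sequentially. \<kappa> n < e"
    by (rule order_tendstoD(2)[OF kappa(2) e])
  ultimately show ?thesis
  proof eventually_elim
    case (elim n)
    have "?N (f n) \<le> ?E (f n) / e"
      using integral_powr_le_growth_energy[OF subsetD[OF A f[of n]]] e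
      by (simp only: pos_le_divide_eq mult.commute[of e])
    then have "\<kappa> n * ?N (f n) \<le> \<kappa> n * (?E (f n) / e)"
      by (rule mult_left_mono[OF _ kappa(1)])
    \<comment> \<open>Pass from the energy to \<open>J n\<close> at \<open>f n\<close>, use
      minimality there, and return to the energy at \<open>h\<close>; each passage costs one error
      term.\<close>
    moreover have "?E (f n) \<le> ?E h + \<kappa> n * (m + ?N (f n)) + \<kappa> n * (m + ?N h)"
      using err[OF f[of n], of n] err[OF h, of n] min[OF h, of n] by linarith
    ultimately have "?E (f n) * (1 - \<kappa> n / e) \<le> ?E h + \<kappa> n * (2 * m + ?N h)"
      by (simp add: algebra_simps)
    moreover have "0 < 1 - \<kappa> n / e" using elim e by simp
    ultimately have "?E (f n) \<le> b n"
      unfolding b_def by (simp add: pos_le_divide_eq)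
    with elim show ?case by simp
  qed
qed

end

section \<open>The Beckmann problems\<close>

text \<open>For \<open>norm v \<le> \<delta>\<close> both integrands are small:
  \<open>2 * W * \<delta>\<close> covers the weighted terms and
  \<open>\<epsilon> / p * \<delta> powr p\<close> the power. For larger \<open>v\<close> the
  weighted parts differ by \<open>3 / 2 * \<delta> * w x\<close>, and
  \<open>\<epsilon> * \<delta>\<close> pays for shifting the argument of the power by
  \<delta>.\<close>

lemma G_star_error:
  fixes v :: "real^'d"
  assumes p: "1 < p" and eps: "0 < \<epsilon>" and d: "0 < \<delta>" and w: "0 \<le> w x" "w x \<le> W"
  shows "\<bar>G_star p \<epsilon> \<delta> w x v - growth_integrand p (\<epsilon> / p) w x v\<bar>
    \<le> (2 * W * \<delta> + \<epsilon> / p * \<delta> powr p + \<epsilon> * \<delta>) * (1 + norm v powr p)"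
    (is "_ \<le> ?k * _")
proof -
  have W\<delta>: "0 \<le> \<delta> * w x" "\<delta> * w x \<le> W * \<delta>" "0 \<le> W * \<delta>"
    using w d mult_right_mono[OF w(2), of \<delta>] by (simp_all add: mult.commute)
  have P: "0 \<le> \<epsilon> / p * \<delta> powr p" "0 \<le> \<epsilon> * \<delta>" "0 \<le> norm v powr p"
    using p eps d by auto
  have "0 \<le> ?k * norm v powr p"
    using W\<delta> P by (intro mult_nonneg_nonneg) auto
  then have k: "?k \<le> ?k * (1 + norm v powr p)"
    by (simp only: distrib_left mult_1_right)
  show ?thesis
  proof (cases "norm v \<le> \<delta>")
    case True
    have "(norm v)\<^sup>2 \<le> \<delta>\<^sup>2"
      using True by (simp add: power_mono)
    then have "(norm v)\<^sup>2 * (w x / (2 * \<delta>)) \<le> \<delta>\<^sup>2 * (w x / (2 * \<delta>))"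
      using w d by (intro mult_right_mono) auto
    also have "\<dots> = \<delta> * w x / 2"
      using d by (simp add: power2_eq_square)
    finally have 1: "(norm v)\<^sup>2 * (w x / (2 * \<delta>)) \<le> \<delta> * w x / 2" .
    have 2: "0 \<le> (norm v)\<^sup>2 * (w x / (2 * \<delta>))"
      using w d by auto
    have 3: "w x * norm v \<le> \<delta> * w x" "0 \<le> w x * norm v"
      using mult_left_mono[OF True w(1)] w(1) by (simp_all add: mult.commute)
    have "norm v powr p \<le> \<delta> powr p"
      using True p by (intro powr_mono2) auto
    then have 4: "\<epsilon> / p * norm v powr p \<le> \<epsilon> / p * \<delta> powr p" "0 \<le> \<epsilon> / p * norm v powr p"
      using p eps by (auto intro!: divide_right_mono mult_left_mono)
    have "\<bar>G_star p \<epsilon> \<delta> w x v - growth_integrand p (\<epsilon> / p) w x v\<bar> \<le> ?k"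
      unfolding G_star_def growth_integrand_def using True 1 2 3 4 W\<delta> P by simp
    with k show ?thesis by linarith
  next
    case False
    then have v: "\<delta> < norm v" by simp
    \<comment> \<open>The tangent at \<open>norm v\<close>, evaluated at
      \<open>norm v - \<delta>\<close>, makes the loss caused by the shift linear in
      \<delta>.\<close>
    have "norm v powr p + p * norm v powr (p - 1) * ((norm v - \<delta>) - norm v) \<le> (norm v - \<delta>) powr p"
      using p d v by (intro powr_ge_tangent) auto
    then have "norm v powr p - (norm v - \<delta>) powr p \<le> p * \<delta> * norm v powr (p - 1)"
      by (simp add: algebra_simps)
    also have "\<dots> \<le> p * \<delta> * (1 + norm v powr p)"
      using p d by (intro mult_left_mono powr_le_one_add_powr) auto
    finally have "\<epsilon> / p * (norm v powr p - (norm v - \<delta>) powr p) \<le> \<epsilon> / p * (p * \<delta> * (1 + norm v powr p))"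
      using p eps by (intro mult_left_mono) auto
    then have 1: "\<epsilon> / p * norm v powr p - \<epsilon> / p * (norm v - \<delta>) powr p \<le> \<epsilon> * \<delta> * (1 + norm v powr p)"
      using p by (simp add: right_diff_distrib)
    have "(norm v - \<delta>) powr p \<le> norm v powr p"
      using p d v by (intro powr_mono2) auto
    then have 2: "\<epsilon> / p * (norm v - \<delta>) powr p \<le> \<epsilon> / p * norm v powr p"
      using p eps by (intro mult_left_mono) auto
    have 3: "(2 * W * \<delta> + \<epsilon> / p * \<delta> powr p) * 1 \<le> (2 * W * \<delta> + \<epsilon> / p * \<delta> powr p) * (1 + norm v powr p)"
      using W\<delta> P by (intro mult_left_mono) auto
    have "\<bar>G_star p \<epsilon> \<delta> w x v - growth_integrand p (\<epsilon> / p) w x v\<bar>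
      \<le> 2 * W * \<delta> + \<epsilon> * \<delta> * (1 + norm v powr p)"
      unfolding G_star_def growth_integrand_def using v 1 2 W\<delta> by (simp add: algebra_simps)
    also have "\<dots> \<le> (2 * W * \<delta> + \<epsilon> / p * \<delta> powr p) * (1 + norm v powr p) + \<epsilon> * \<delta> * (1 + norm v powr p)"
      using P by (intro add_right_mono order_trans[OF _ 3]) simp
    finally show ?thesis by (simp add: algebra_simps)
  qed
qed

section \<open>Function spaces and energies on compact domains\<close>

lemma Lp_eq_Lp_space: "Lp p K = Lp_space p (lebesgue_on K)"
  by (simp add: Lp_def Lp_space_def)

text \<open>\<open>grad\<close> is an arbitrary choice of weak gradient; membership in
  \<open>W1\<close> says that there is one to choose.\<close>

lemma grad_in_Lp_space: "v \<in> W1 p K \<Longrightarrow> grad p K v \<in> Lp_space p (lebesgue_on K)"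
  unfolding W1_def grad_def Lp_eq_Lp_space[symmetric]
  by (auto intro: someI2[where Q = "\<lambda>g. g \<in> Lp p K"])

lemma finite_measure_lebesgue_on_compact:
  fixes K :: "'a::euclidean_space set"
  assumes "compact K"
  shows "finite_measure (lebesgue_on K)"
  using lmeasurable_compact[OF assms] by (intro finite_measure_lebesgue_on)

lemma continuous_borel_measurable_lebesgue_on_compact:
  fixes f :: "'a::euclidean_space \<Rightarrow> 'b::euclidean_space"
  assumes "compact K" "continuous_on K f"
  shows "f \<in> borel_measurable (lebesgue_on K)"
  using assms lmeasurable_compact[OF assms(1)]
  by (intro continuous_imp_measurable_on_sets_lebesgue) (auto dest: fmeasurableD)

lemma continuous_on_compact_norm_bound:
  fixes f :: "'a::euclidean_space \<Rightarrow> 'b::real_normed_vector"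
  assumes "compact K" "continuous_on K f"
  shows "\<exists>B\<ge>0. \<forall>x\<in>K. norm (f x) \<le> B"
proof -
  have "bounded (f ` K)"
    by (rule compact_imp_bounded[OF compact_continuous_image[OF assms(2,1)]])
  then obtain B where "0 < B" "\<forall>y\<in>f ` K. norm y \<le> B"
    unfolding bounded_pos by blast
  then show ?thesis
    by (intro exI[of _ B]) auto
qed

lemma continuous_in_Lp_space:
  fixes f :: "'a::euclidean_space \<Rightarrow> 'b::euclidean_space"
  assumes K: "compact K" and f: "continuous_on K f" and p: "0 \<le> p"
  shows "f \<in> Lp_space p (lebesgue_on K)"
proof -
  interpret finite_measure "lebesgue_on K"
    by (rule finite_measure_lebesgue_on_compact[OF K])
  have [measurable]: "f \<in> borel_measurable (lebesgue_on K)"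
    by (rule continuous_borel_measurable_lebesgue_on_compact[OF K f])
  obtain B where B: "0 \<le> B" "\<And>x. x \<in> K \<Longrightarrow> norm (f x) \<le> B"
    using continuous_on_compact_norm_bound[OF K f] by blast
  have "integrable (lebesgue_on K) (\<lambda>x. norm (f x) powr p)"
  proof (rule integrable_const_bound[where B = "B powr p"])
    show "AE x in lebesgue_on K. norm (norm (f x) powr p) \<le> B powr p"
      using B p by (intro AE_I2) (auto intro!: powr_mono2)
  qed measurable
  then show ?thesis by (simp add: Lp_space_def)
qed

lemma regularized_beckmann_energy_eq:
  assumes p: "1 < p" and w: "growth_functional (lebesgue_on K) p e W w"
    and q: "q \<in> Lp_space p (lebesgue_on K)"
  shows "regularized_beckmann_energy p \<epsilon> w K q = growth_energy p (\<epsilon> / p) w (lebesgue_on K) q"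
proof -
  have "Lp_norm p K q powr p = (\<integral>x. norm (q x) powr p \<partial>lebesgue_on K)"
    using p by (simp add: Lp_norm_def powr_powr)
  then show ?thesis
    unfolding regularized_beckmann_energy_def growth_energy_def growth_integrand_def
    using growth_functional.weighted_norm_integrable[OF w q] Lp_space_integrable[OF q] by simp
qed

lemma doubly_regularized_energy_error:
  assumes K: "compact K" and p: "1 < p" and eps: "0 < \<epsilon>" and d: "0 < \<delta>"
    and w: "growth_functional (lebesgue_on K) p (\<epsilon> / p) W w"
    and q: "q \<in> Lp_space p (lebesgue_on K)"
  shows "\<bar>doubly_regularized_energy p \<epsilon> \<delta> w K q - growth_energy p (\<epsilon> / p) w (lebesgue_on K) q\<bar>
    \<le> (2 * W * \<delta> + \<epsilon> / p * \<delta> powr p + \<epsilon> * \<delta>)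
      * (measure lebesgue K + (\<integral>x. norm (q x) powr p \<partial>lebesgue_on K))"
    (is "_ \<le> ?k * _")
proof -
  let ?M = "lebesgue_on K"
  interpret growth_functional ?M p "\<epsilon> / p" W w by fact
  note [measurable] = q
  define D where "D x = G_star p \<epsilon> \<delta> w x (q x) - growth_integrand p (\<epsilon> / p) w x (q x)" for x
  have D: "\<bar>D x\<bar> \<le> ?k * (1 + norm (q x) powr p)" if "x \<in> space ?M" for x
    unfolding D_def using w_nonneg[OF that] w_le[OF that] by (intro G_star_error p eps d)
  have bd: "integrable ?M (\<lambda>x. ?k * (1 + norm (q x) powr p))"
    using Lp_space_integrable[OF q] by simp
  have intF: "integrable ?M (\<lambda>x. growth_integrand p (\<epsilon> / p) w x (q x))"
    by (rule growth_integrand_integrable[OF q])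
  \<comment> \<open>Bochner integrals of nonintegrable functions are 0 by convention, so the doubly
    regularized energy can be split only after its integrand is known to be integrable. The
    pointwise error bound provides this.\<close>
  have intD: "integrable ?M D"
  proof (rule Bochner_Integration.integrable_bound[OF bd])
    show "D \<in> borel_measurable ?M"
      unfolding D_def G_star_def growth_integrand_def by measurable
    show "AE x in ?M. norm (D x) \<le> norm (?k * (1 + norm (q x) powr p))"
      using D by (intro AE_I2) (force intro: order_trans[OF _ abs_ge_self])
  qed
  have "doubly_regularized_energy p \<epsilon> \<delta> w K q
      = (\<integral>x. growth_integrand p (\<epsilon> / p) w x (q x) + D x \<partial>?M)"
    by (simp add: doubly_regularized_energy_def D_def)
  also have "\<dots> = growth_energy p (\<epsilon> / p) w ?M q + (\<integral>x. D x \<partial>?M)"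
    using intF intD by (simp add: growth_energy_def)
  finally have "\<bar>doubly_regularized_energy p \<epsilon> \<delta> w K q - growth_energy p (\<epsilon> / p) w ?M q\<bar>
      = \<bar>\<integral>x. D x \<partial>?M\<bar>"
    by simp
  also have "\<dots> \<le> (\<integral>x. \<bar>D x\<bar> \<partial>?M)"
    by (rule integral_abs_bound)
  also have "\<dots> \<le> (\<integral>x. ?k * (1 + norm (q x) powr p) \<partial>?M)"
    using intD bd D by (intro integral_mono) auto
  also have "\<dots> = ?k * (\<integral>x. 1 + norm (q x) powr p \<partial>?M)"
    by (rule integral_mult_right_zero)
  also have "(\<integral>x. 1 + norm (q x) powr p \<partial>?M) = measure ?M (space ?M) + (\<integral>x. norm (q x) powr p \<partial>?M)"
    using Lp_space_integrable[OF q] by simp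
  also have "measure ?M (space ?M) = measure lebesgue K"
    using lmeasurable_compact[OF K] by (simp add: measure_restrict_space fmeasurableD)
  finally show ?thesis .
qed

text \<open>The constant in the continuity estimate is the integral of \<open>norm (q x)\<close>,
  finite because a compact set has finite measure.\<close>

lemma density_measure_in_vector_radon_measures:
  fixes q :: "real^'d \<Rightarrow> real^'d"
  assumes K: "compact K" and p: "1 < p" and q: "q \<in> Lp_space p (lebesgue_on K)"
  shows "density_measure K q \<in> vector_radon_measures K"
proof -
  let ?M = "lebesgue_on K"
  have int: "integrable ?M (\<lambda>x. \<psi> x \<bullet> q x)" if "continuous_on K \<psi>" for \<psi>
    using Lp_pairing_integrable[OF p q continuous_in_Lp_space[OF K that, of "conj_exp p"]]
      conj_exp_props[OF p] by (simp add: inner_commute)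
  have intq: "integrable ?M (\<lambda>x. norm (q x))"
    by (rule Lp_space_norm_integrable[OF finite_measure_lebesgue_on_compact[OF K] p q])
  have "\<bar>density_measure K q \<psi>\<bar> \<le> (\<integral>x. norm (q x) \<partial>?M) * (SUP x\<in>K. norm (\<psi> x))"
    if \<psi>: "continuous_on K \<psi>" for \<psi> :: "real^'d \<Rightarrow> real^'d"
  proof -
    let ?S = "SUP x\<in>K. norm (\<psi> x)"
    have "bdd_above ((\<lambda>x. norm (\<psi> x)) ` K)"
      by (intro compact_imp_bounded[THEN bounded_imp_bdd_above] compact_continuous_image
          continuous_intros \<psi> K)
    then have S: "norm (\<psi> x) \<le> ?S" if "x \<in> K" for x
      using that by (rule cSUP_upper2) auto
    have "\<bar>density_measure K q \<psi>\<bar> \<le> (\<integral>x. \<bar>\<psi> x \<bullet> q x\<bar> \<partial>?M)"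
      unfolding density_measure_def by (rule integral_abs_bound)
    also have "\<dots> \<le> (\<integral>x. norm (q x) * ?S \<partial>?M)"
    proof (rule integral_mono)
      fix x assume "x \<in> space ?M"
      then have "x \<in> K" by simp
      have "\<bar>\<psi> x \<bullet> q x\<bar> \<le> norm (\<psi> x) * norm (q x)" by (rule Cauchy_Schwarz_ineq2)
      also have "\<dots> \<le> ?S * norm (q x)" using S[OF \<open>x \<in> K\<close>] by (intro mult_right_mono) auto
      finally show "\<bar>\<psi> x \<bullet> q x\<bar> \<le> norm (q x) * ?S" by (simp add: mult.commute)
    qed (use int[OF \<psi>] intq in auto)
    also have "\<dots> = (\<integral>x. norm (q x) \<partial>?M) * ?S"
      by (rule integral_mult_left_zero)
    finally show ?thesis .
  qed
  then show ?thesis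
    unfolding vector_radon_measures_def using int
    by (auto simp: density_measure_def inner_add_left)
qed

text \<open>A continuous field on a compact set lies in the dual Lebesgue space, so convergence in
  the Lebesgue norm passes to the pairing with it.\<close>

lemma density_measure_weak_star_converges:
  fixes q :: "nat \<Rightarrow> real^'d \<Rightarrow> real^'d"
  assumes K: "compact K" and p: "1 < p" and q: "\<And>n. q n \<in> Lp_space p (lebesgue_on K)"
    and h: "h \<in> Lp_space p (lebesgue_on K)"
    and lim: "(\<lambda>n. dist_powr p (lebesgue_on K) (q n) h) \<longlonglongrightarrow> 0"
  shows "weak_star_converges K (\<lambda>n. density_measure K (q n)) (density_measure K h)"
proof -
  have "(\<lambda>n. density_measure K (q n) \<psi>) \<longlonglongrightarrow> density_measure K h \<psi>" if "continuous_on K \<psi>" for \<psi>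
    using Lp_pairing_tendsto[OF p q h lim continuous_in_Lp_space[OF K that, of "conj_exp p"]]
      conj_exp_props[OF p] by (simp add: density_measure_def inner_commute)
  then show ?thesis
    unfolding weak_star_converges_def
    using density_measure_in_vector_radon_measures[OF K p] q h by blast
qed

section \<open>The admissible set and passage to the limit\<close>

lemma admissible_midpoint:
  assumes p: "1 < p" and f: "f \<in> admissible p K P N" and g: "g \<in> admissible p K P N"
  shows "(\<lambda>x. (1 / 2) *\<^sub>R (f x + g x)) \<in> admissible p K P N"
proof -
  have fL: "f \<in> Lp_space p (lebesgue_on K)" and gL: "g \<in> Lp_space p (lebesgue_on K)"
    using f g by (auto simp: admissible_def Lp_eq_Lp_space)
  have "divergence p K (\<lambda>x. (1 / 2) *\<^sub>R (f x + g x)) \<phi> = measure_functional K P N \<phi>"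
    if \<phi>: "\<phi> \<in> W1_mean0 (conj_exp p) K" for \<phi>
  proof -
    have G: "grad (conj_exp p) K \<phi> \<in> Lp_space (conj_exp p) (lebesgue_on K)"
      using \<phi> by (intro grad_in_Lp_space) (simp add: W1_mean0_def)
    have "divergence p K (\<lambda>x. (1 / 2) *\<^sub>R (f x + g x)) \<phi>
        = - (1 / 2 * ((\<integral>x. f x \<bullet> grad (conj_exp p) K \<phi> x \<partial>lebesgue_on K)
          + (\<integral>x. g x \<bullet> grad (conj_exp p) K \<phi> x \<partial>lebesgue_on K)))"
      unfolding divergence_def inner_scaleR_left inner_add_left integral_mult_right_zero
      using Lp_pairing_integrable[OF p fL G] Lp_pairing_integrable[OF p gL G]
      by (subst Bochner_Integration.integral_add) auto
    also have "\<dots> = (divergence p K f \<phi> + divergence p K g \<phi>) / 2"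
      unfolding divergence_def by (simp add: field_simps)
    also have "\<dots> = measure_functional K P N \<phi>"
      using f g \<phi> by (simp add: admissible_def)
    finally show ?thesis .
  qed
  moreover have "(\<lambda>x. (1 / 2) *\<^sub>R (f x + g x)) \<in> Lp_space p (lebesgue_on K)"
    by (intro Lp_space_scaleR Lp_space_add p fL gL)
  ultimately show ?thesis by (simp add: admissible_def Lp_eq_Lp_space)
qed

lemma admissible_limit:
  assumes p: "1 < p" and f: "\<And>n. f n \<in> admissible p K P N"
    and h: "h \<in> Lp_space p (lebesgue_on K)"
    and lim: "(\<lambda>n. dist_powr p (lebesgue_on K) (f n) h) \<longlonglongrightarrow> 0"
  shows "h \<in> admissible p K P N"
proof -
  have fL: "f n \<in> Lp_space p (lebesgue_on K)" for n
    using f[of n] by (simp add: admissible_def Lp_eq_Lp_space)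
  have "divergence p K h \<phi> = measure_functional K P N \<phi>"
    if \<phi>: "\<phi> \<in> W1_mean0 (conj_exp p) K" for \<phi>
  proof -
    have G: "grad (conj_exp p) K \<phi> \<in> Lp_space (conj_exp p) (lebesgue_on K)"
      using \<phi> by (intro grad_in_Lp_space) (simp add: W1_mean0_def)
    have "(\<lambda>n. divergence p K (f n) \<phi>) \<longlonglongrightarrow> divergence p K h \<phi>"
      unfolding divergence_def by (intro tendsto_minus Lp_pairing_tendsto[OF p fL h lim G])
    moreover have "divergence p K (f n) \<phi> = measure_functional K P N \<phi>" for n
      using f[of n] \<phi> by (simp add: admissible_def)
    ultimately show ?thesis by (simp add: LIMSEQ_const_iff)
  qed
  with h show ?thesis by (simp add: admissible_def Lp_eq_Lp_space)
qed

lemma doubly_regularized_minimizers_converge: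
  fixes K :: "(real^'d) set"
  assumes K: "compact K" and p: "1 < p" and eps: "0 < \<epsilon>"
    and w: "continuous_on K w" "\<And>x. x \<in> K \<Longrightarrow> 0 \<le> w x"
    and \<delta>: "\<And>n. 0 < \<delta> n" "\<delta> \<longlonglongrightarrow> 0"
    and q: "\<And>n. is_arg_min (doubly_regularized_energy p \<epsilon> (\<delta> n) w K)
      (\<lambda>f. f \<in> admissible p K P N) (q n)"
  shows "\<exists>r q\<^sub>0. strict_mono r \<and>
    is_arg_min (regularized_beckmann_energy p \<epsilon> w K) (\<lambda>f. f \<in> admissible p K P N) q\<^sub>0 \<and>
    weak_star_converges K (\<lambda>n. density_measure K (q (r n))) (density_measure K q\<^sub>0)"
proof -
  let ?M = "lebesgue_on K"
  let ?A = "admissible p K P N"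
  let ?E = "growth_energy p (\<epsilon> / p) w ?M :: (real^'d \<Rightarrow> real^'d) \<Rightarrow> real"
  obtain W where W: "0 \<le> W" "\<And>x. x \<in> K \<Longrightarrow> norm (w x) \<le> W"
    using continuous_on_compact_norm_bound[OF K w(1)] by blast
  interpret finite_measure ?M
    by (rule finite_measure_lebesgue_on_compact[OF K])
  have gf: "growth_functional ?M p (\<epsilon> / p) W w"
    using p eps w W continuous_borel_measurable_lebesgue_on_compact[OF K w(1)]
    by unfold_locales (auto simp: abs_le_iff)
  interpret growth_functional ?M p "\<epsilon> / p" W w by (rule gf)
  have A: "?A \<subseteq> Lp_space p ?M"
    by (auto simp: admissible_def Lp_eq_Lp_space)
  have qA: "q n \<in> ?A" for n
    using q[of n] by (simp add: is_arg_min_def)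
  \<comment> \<open>The factor from \<open>G_star_error\<close> at \<open>\<delta> n\<close>; every
    summand carries a positive power of \<open>\<delta> n\<close>.\<close>
  define \<kappa> where "\<kappa> n = 2 * W * \<delta> n + \<epsilon> / p * \<delta> n powr p + \<epsilon> * \<delta> n" for n
  have \<kappa>_nonneg: "0 \<le> \<kappa> n" for n
    using W(1) \<delta>(1)[of n] p eps unfolding \<kappa>_def
    by (intro add_nonneg_nonneg mult_nonneg_nonneg divide_nonneg_nonneg) auto
  have "(\<lambda>n. \<delta> n powr p) \<longlonglongrightarrow> 0 powr p"
    using p less_imp_le[OF \<delta>(1)] by (intro tendsto_powr' \<delta>(2) tendsto_const) auto
  then have "\<kappa> \<longlonglongrightarrow> 2 * W * 0 + \<epsilon> / p * 0 + \<epsilon> * 0"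
    unfolding \<kappa>_def by (intro tendsto_add tendsto_mult_left \<delta>(2)) auto
  then have \<kappa>_lim: "\<kappa> \<longlonglongrightarrow> 0" by simp
  have minimizing: "\<forall>\<^sub>F n in sequentially. ?E (q n) \<le> ?E h + c" if h: "h \<in> ?A" and c: "0 < c" for h c
  proof (rule minimizers_of_perturbations_minimizing[OF A qA _ _ \<kappa>_nonneg \<kappa>_lim h c])
    show "doubly_regularized_energy p \<epsilon> (\<delta> n) w K (q n) \<le> doubly_regularized_energy p \<epsilon> (\<delta> n) w K g"
      if "g \<in> ?A" for n g
      using q[of n] that by (simp add: is_arg_min_linorder)
    show "\<bar>doubly_regularized_energy p \<epsilon> (\<delta> n) w K g - ?E g\<bar>
        \<le> \<kappa> n * (measure lebesgue K + (\<integral>x. norm (g x) powr p \<partial>?M))" if "g \<in> ?A" for n g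
      using doubly_regularized_energy_error[OF K p eps \<delta>(1) gf] A that unfolding \<kappa>_def by blast
  qed
  obtain r q\<^sub>0 where r: "strict_mono r" and q0: "q\<^sub>0 \<in> Lp_space p ?M"
    and lim: "(\<lambda>k. dist_powr p ?M (q (r k)) q\<^sub>0) \<longlonglongrightarrow> 0"
    and min: "\<And>h. h \<in> ?A \<Longrightarrow> ?E q\<^sub>0 \<le> ?E h"
    using minimizing_sequence_convergent[OF A admissible_midpoint[OF p] qA minimizing] by blast
  have "q\<^sub>0 \<in> ?A"
    by (rule admissible_limit[OF p qA q0 lim])
  moreover have "regularized_beckmann_energy p \<epsilon> w K f = ?E f" if "f \<in> ?A" for f
    using regularized_beckmann_energy_eq[OF p gf] A that by blast
  ultimately have "is_arg_min (regularized_beckmann_energy p \<epsilon> w K) (\<lambda>f. f \<in> ?A) q\<^sub>0"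
    using min by (simp add: is_arg_min_linorder)
  moreover have "weak_star_converges K (\<lambda>n. density_measure K (q (r n))) (density_measure K q\<^sub>0)"
    using A qA by (intro density_measure_weak_star_converges[OF K p _ q0 lim]) blast
  ultimately show ?thesis using r by blast
qed

theorem corollary4p9:
  fixes \<Omega> :: "(real^'d) set"
    and w w_hat :: "real^'d \<Rightarrow> real"
    and \<alpha> \<epsilon> :: real
    and \<mu>_pos \<mu>_neg :: "(real^'d) measure"
    and \<tau> :: "nat \<Rightarrow> real"
    and mollifier :: "real \<Rightarrow> real^'d \<Rightarrow> real"
    and s :: "real \<Rightarrow> real"
    and \<delta> :: "nat \<Rightarrow> real"
    and q :: "nat \<Rightarrow> real^'d \<Rightarrow> real^'d"
  defines "\<Omega>_enl \<equiv> \<lambda>t. enlarge \<Omega> (s t)"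
  defines "\<Omega>_tilde \<equiv> \<Union>t\<in>range \<tau>. \<Omega>_enl t"
  defines "\<mu>_tilde_pos \<equiv> extension_by_zero (\<Omega>_enl \<epsilon>) \<mu>_pos"
  defines "\<mu>_tilde_neg \<equiv> extension_by_zero (\<Omega>_enl \<epsilon>) \<mu>_neg"
  assumes \<Omega>_compact: "compact \<Omega>"
    and \<Omega>_lipschitz: "bounded_lipschitz_domain (interior \<Omega>)"
    and \<Omega>_star_shaped: "\<And>x t. x \<in> \<Omega> \<Longrightarrow> 0 \<le> t \<Longrightarrow> t < 1 \<Longrightarrow> t *\<^sub>R x \<in> interior \<Omega>"
    and w_continuous: "continuous_on \<Omega> w"
    and w_nonneg: "\<And>x. x \<in> \<Omega> \<Longrightarrow> 0 \<le> w x"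
    and \<alpha>_gt_1: "1 < \<alpha>"
    and \<alpha>_less: "CARD('d) = 1 \<or> \<alpha> < real CARD('d) / (real CARD('d) - 1)"
    and \<mu>_pos: "borel_prob_on \<Omega> \<mu>_pos"
    and \<mu>_neg: "borel_prob_on \<Omega> \<mu>_neg"
    and \<Omega>_neumann: "neumann_uniquely_solvable (conj_exp \<alpha>) \<Omega>"
    and \<tau>_pos: "\<And>k. 0 < \<tau> k"
    and \<tau>_lim: "\<tau> \<longlonglongrightarrow> 0"
    and mollifier_smooth: "\<And>k. mollifier (\<tau> k) \<in> Cc_infinity UNIV"
    and mollifier_nonneg: "\<And>k x. 0 \<le> mollifier (\<tau> k) x"
    and mollifier_integral: "\<And>k. (\<integral>x. mollifier (\<tau> k) x \<partial>lborel) = 1"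
    and mollifier_shrink: "\<And>r. 0 < r \<Longrightarrow> \<forall>\<^sub>F k in sequentially. supp (mollifier (\<tau> k)) \<subseteq> ball 0 r"
    and s_pos: "\<And>k. 0 < s (\<tau> k)"
    and s_lim: "(\<lambda>k. s (\<tau> k)) \<longlonglongrightarrow> 0"
    and \<Omega>_enl_supp: "\<And>k. {x + y |x y. x \<in> \<Omega> \<and> y \<in> supp (mollifier (\<tau> k))} \<subseteq> \<Omega>_enl (\<tau> k)"
    and \<Omega>_enl_mono: "\<And>j k. \<tau> k < \<tau> j \<Longrightarrow> \<Omega>_enl (\<tau> k) \<subseteq> \<Omega>_enl (\<tau> j)"
    and w_hat_continuous: "continuous_on \<Omega>_tilde w_hat"
    and w_hat_extends: "\<And>x. x \<in> \<Omega> \<Longrightarrow> w_hat x = w x"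
    and w_hat_min: "\<exists>m. is_minimum_value w_hat \<Omega>_tilde m \<and> is_minimum_value w \<Omega> m"
    and \<epsilon>_param: "\<epsilon> \<in> range \<tau>"
    and \<delta>_pos: "\<And>n. 0 < \<delta> n"
    and \<delta>_lim: "\<delta> \<longlonglongrightarrow> 0"
    and q_solution: "\<And>n. is_arg_min (doubly_regularized_energy \<alpha> \<epsilon> (\<delta> n) w_hat (\<Omega>_enl \<epsilon>))
          (\<lambda>p. p \<in> admissible \<alpha> (\<Omega>_enl \<epsilon>) \<mu>_tilde_pos \<mu>_tilde_neg) (q n)"
  shows "\<exists>r q\<^sub>0. strict_mono r \<and>
     is_arg_min (regularized_beckmann_energy \<alpha> \<epsilon> w_hat (\<Omega>_enl \<epsilon>))
       (\<lambda>p. p \<in> admissible \<alpha> (\<Omega>_enl \<epsilon>) \<mu>_tilde_pos \<mu>_tilde_neg) q\<^sub>0 \<and>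
     weak_star_converges (\<Omega>_enl \<epsilon>)
       (\<lambda>n. density_measure (\<Omega>_enl \<epsilon>) (q (r n))) (density_measure (\<Omega>_enl \<epsilon>) q\<^sub>0)"
proof -
  have \<Omega>_enl_tilde: "\<Omega>_enl \<epsilon> \<subseteq> \<Omega>_tilde"
    using \<epsilon>_param unfolding \<Omega>_tilde_def by blast
  have K: "compact (\<Omega>_enl \<epsilon>)"
    unfolding \<Omega>_enl_def enlarge_def
    by (intro compact_continuous_image continuous_intros \<Omega>_compact)
  obtain m where m: "is_minimum_value w_hat \<Omega>_tilde m" "is_minimum_value w \<Omega> m"
    using w_hat_min by blast
  \<comment> \<open>An extension could become negative outside \<Omega>. The minimum shared with
    \<open>w\<close> rules this out and gives the sign of the weight on the enlarged domain.\<close>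
  have "0 \<le> m"
    using m(2) w_nonneg by (auto simp: is_minimum_value_def)
  then have w_hat_nonneg: "0 \<le> w_hat x" if "x \<in> \<Omega>_enl \<epsilon>" for x
    using m(1) that \<Omega>_enl_tilde unfolding is_minimum_value_def by (meson order_trans subsetD)
  show ?thesis
  proof (rule doubly_regularized_minimizers_converge[OF K \<alpha>_gt_1 _ _ w_hat_nonneg \<delta>_pos \<delta>_lim q_solution])
    show "0 < \<epsilon>"
      using \<epsilon>_param \<tau>_pos by auto
    show "continuous_on (\<Omega>_enl \<epsilon>) w_hat"
      by (rule continuous_on_subset[OF w_hat_continuous \<Omega>_enl_tilde])
  qed
qed

end
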